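(* Let $X$ be a $q$-dimensional $C^1$ submanifold of $\mathbb{R}^L$, let $\Phi\in\operatorname{Diff}^1(X)$, and let $X'$ be a compact $\Phi$-invariant subset of $X$. For a point $\mathbf{x}\in X'$ let $(\widetilde{\mathbf{x}}_t)_{t\ge0}$ be its forward trajectory, $\widetilde{\mathbf{x}}_0=\mathbf{x}$ and $\widetilde{\mathbf{x}}_t=\Phi(\widetilde{\mathbf{x}}_{t-1})$ for $t\in\mathbb{N}=\{1,2,\dots\}$. Given a sequence $(\mathbf{C}_t)_{t\in\mathbb{N}}$ with $\mathbf{C}_t\in T_{\widetilde{\mathbf{x}}_t}X$ and $\|\mathbf{C}_t\|\le K$ for all $t\in\mathbb{N}$, where $K>0$ is a constant, define the sequence $(\mathbf{a}_t)$ by $$\mathbf{a}_0=0,\qquad \mathbf{a}_t=\mathbf{C}_t+D\Phi(\widetilde{\mathbf{x}}_{t-1})\,\mathbf{a}_{t-1},\quad t\in\mathbb{N}.$$ Then for any $\Phi$-invariant Borel probability measure on $X'$ there exists a $\Phi$-invariant set $\Lambda\subset X'$ of full measure such that for every $\mathbf{x}\in\Lambda$ and every sufficiently small $\delta>0$ there is a constant $R=R(\delta,\mathbf{x})$, depending on the initial point $\mathbf{x}$ and on $\delta$, such that the corresponding sequence satisfies $$\|\mathbf{a}_t\|\le RK\,e^{t(\lambda_1^{\mathrm{pos}}+\delta)}\quad\text{for all }t\in\mathbb{N},$$ where $\lambda_1=\lambda_1(\mathbf{x})$ is the largest Lyapunov exponent of $\mathbf{x}$ and $\lambda_1^{\m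athrm{pos}}=\max\{\lambda_1,0\}$.
   Context: $\operatorname{Diff}^1(X)$ is the set of $C^1$ diffeomorphisms of $X$ onto itself. Norms are Euclidean, and tangent spaces of $X$ are regarded as subspaces of $\mathbb{R}^L$; $D\Phi(\mathbf{x}):T_{\mathbf{x}}X\to T_{\Phi(\mathbf{x})}X$ is the tangent map. The (forward) Lyapunov exponent of $\mathbf{x}\in X$ along $v\in T_{\mathbf{x}}X$ is $\lambda^+(\mathbf{x},v)=\limsup_{t\to\infty}\frac1t\log\|D\Phi^t(\mathbf{x})v\|$ (with $\log0=-\infty$); it takes finitely many values on $T_{\mathbf{x}}X\setminus\{0\}$, and $\lambda_1(\mathbf{x})$ is the largest of them. *)

theory Defs
  imports "HOL-Probability.Probability"
begin

definition C1_on :: "'a::euclidean_space set \<Rightarrow> ('a \<Rightarrow> 'b::euclidean_space) \<Rightarrow> bool" where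
  "C1_on U f \<longleftrightarrow> open U \<and>
     (\<exists>f'. (\<forall>x\<in>U. (f has_derivative blinfun_apply (f' x)) (at x)) \<and> continuous_on U f')"

definition C1_submanifold :: "nat \<Rightarrow> 'a::euclidean_space set \<Rightarrow> bool" where
  "C1_submanifold q X \<longleftrightarrow>
     (\<forall>x\<in>X. \<exists>U V \<phi> \<psi> S. x \<in> U \<and> C1_on U (\<phi> :: 'a \<Rightarrow> 'a) \<and> C1_on V (\<psi> :: 'a \<Rightarrow> 'a) \<and>
        homeomorphism U V \<phi> \<psi> \<and> subspace S \<and> dim S = q \<and> \<phi> ` (X \<inter> U) = V \<inter> S)"

(* For a submanifold X of R^L, a map on X is C^1 iff it locally extends to a C^1 map
   of the ambient space. *)
definition C1_map :: "'a::euclidean_space set \<Rightarrow> ('a \<Rightarrow> 'b::euclidean_space) \<Rightarrow> bool" where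
  "C1_map X f \<longleftrightarrow> (\<forall>x\<in>X. \<exists>U F. x \<in> U \<and> C1_on U F \<and> (\<forall>y\<in>X \<inter> U. F y = f y))"

definition C1_diffeo :: "'a::euclidean_space set \<Rightarrow> ('a \<Rightarrow> 'a) \<Rightarrow> bool" where
  "C1_diffeo X f \<longleftrightarrow> bij_betw f X X \<and> C1_map X f \<and> C1_map X (inv_into X f)"

definition tangent_space :: "'a::euclidean_space set \<Rightarrow> 'a \<Rightarrow> 'a set" where
  "tangent_space X x = {v. \<exists>\<gamma> \<epsilon>. \<epsilon> > 0 \<and> \<gamma> C1_differentiable_on {-\<epsilon><..<\<epsilon>} \<and>
     \<gamma> ` {-\<epsilon><..<\<epsilon>} \<subseteq> X \<and> \<gamma> 0 = x \<and> (\<gamma> has_vector_derivative v) (at (0::real))}"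

(* The derivative within X is in general not unique as a linear map on R^L, but it is on
   tangent vectors, where it gives the velocity of the image curve: see
   tangent_map_curve and tangent_map_eq.  It is only ever applied to tangent vectors. *)
definition tangent_map ::
    "'a::euclidean_space set \<Rightarrow> ('a \<Rightarrow> 'b::euclidean_space) \<Rightarrow> 'a \<Rightarrow> 'a \<Rightarrow> 'b" where
  "tangent_map X f x v = frechet_derivative f (at x within X) v"

definition ext_log :: "real \<Rightarrow> ereal" where
  "ext_log r = (if r = 0 then -\<infinity> else ereal (ln r))"

definition lyapunov_exponent :: "'a::euclidean_space set \<Rightarrow> ('a \<Rightarrow> 'a) \<Rightarrow> 'a \<Rightarrow> 'a \<Rightarrow> ereal" where
  "lyapunov_exponent X f x v =
     limsup (\<lambda>t. ereal (1 / real t) * ext_log (norm (tangent_map X (f ^^ t) x v)))"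

(* Only finitely many values occur, so this supremum is the largest of them: see
   largest_lyapunov_eq_Max.  It is -\<infinity> when the tangent space is trivial. *)
definition largest_lyapunov :: "'a::euclidean_space set \<Rightarrow> ('a \<Rightarrow> 'a) \<Rightarrow> 'a \<Rightarrow> ereal" where
  "largest_lyapunov X f x = Sup (lyapunov_exponent X f x ` (tangent_space X x - {0}))"

(* f is a bijection of the ambient manifold, so f ` A = A agrees with f -` A \<inter> X = A. *)
definition invariant_set :: "('a \<Rightarrow> 'a) \<Rightarrow> 'a set \<Rightarrow> bool" where
  "invariant_set f A \<longleftrightarrow> f ` A = A"

definition invariant_borel_prob ::
    "('a::euclidean_space \<Rightarrow> 'a) \<Rightarrow> 'a set \<Rightarrow> 'a measure \<Rightarrow> bool" where
  "invariant_borel_prob f A \<mu> \<longleftrightarrow>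
     sets \<mu> = sets (restrict_space borel A) \<and> prob_space \<mu> \<and>
     f \<in> measurable \<mu> \<mu> \<and> distr \<mu> \<mu> f = \<mu>"

primrec cocycle_sum ::
    "'a::euclidean_space set \<Rightarrow> ('a \<Rightarrow> 'a) \<Rightarrow> 'a \<Rightarrow> (nat \<Rightarrow> 'a) \<Rightarrow> nat \<Rightarrow> 'a" where
  "cocycle_sum X f x C 0 = 0"
| "cocycle_sum X f x C (Suc t) =
     C (Suc t) + tangent_map X f ((f ^^ t) x) (cocycle_sum X f x C t)"


lemma C1_map_differentiable:
  assumes "C1_map X f" "x \<in> X"
  shows "f differentiable (at x within X)"
proof -
  from assms obtain U F where U: "x \<in> U" "C1_on U F" and eq: "\<forall>y\<in>X \<inter> U. F y = f y"
    unfolding C1_map_def by blast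
  from U obtain F' where "open U" "(F has_derivative F') (at x)"
    unfolding C1_on_def by blast
  then have "(F has_derivative F') (at x within X)"
    using has_derivative_at_withinI by blast
  moreover have "eventually (\<lambda>y. F y = f y) (at x within X)"
    using eq U(1) \<open>open U\<close> unfolding eventually_at_topological by blast
  ultimately have "(f has_derivative F') (at x within X)"
    using has_derivative_transform_eventually eq U(1) assms(2) by blast
  then show ?thesis
    unfolding differentiable_def by blast
qed

lemma curve_derivative:
  assumes A: "(f has_derivative A) (at x within X)"
    and e: "\<epsilon> > 0" "\<gamma> ` {-\<epsilon><..<\<epsilon>} \<subseteq> X" "\<gamma> 0 = x"
    and v: "(\<gamma> has_vector_derivative v) (at (0::real))"
  shows "((f \<circ> \<gamma>) has_vector_derivative A v) (at 0)"
proof -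
  have op: "at (0::real) within {-\<epsilon><..<\<epsilon>} = at 0"
    using e(1) by (intro at_within_open) auto
  have 1: "(f has_derivative A) (at (\<gamma> 0) within \<gamma> ` {-\<epsilon><..<\<epsilon>})"
    using A e has_derivative_subset by blast
  have 2: "(\<gamma> has_derivative (\<lambda>h. h *\<^sub>R v)) (at 0 within {-\<epsilon><..<\<epsilon>})"
    using v unfolding op has_vector_derivative_def .
  from has_derivative_in_compose[OF 2 1]
  have "((\<lambda>x. f (\<gamma> x)) has_derivative (\<lambda>h. A (h *\<^sub>R v))) (at 0 within {-\<epsilon><..<\<epsilon>})" .
  moreover have "A (h *\<^sub>R v) = h *\<^sub>R A v" for h
    using has_derivative_linear[OF A] by (rule linear_scale)
  ultimately show ?thesis
    unfolding op has_vector_derivative_def comp_def by simp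
qed

lemma tangent_map_curve:
  assumes "f differentiable (at x within X)"
    and "\<epsilon> > 0" "\<gamma> ` {-\<epsilon><..<\<epsilon>} \<subseteq> X" "\<gamma> 0 = x"
    and "(\<gamma> has_vector_derivative v) (at (0::real))"
  shows "((f \<circ> \<gamma>) has_vector_derivative tangent_map X f x v) (at 0)"
  unfolding tangent_map_def
  using assms(1)[unfolded frechet_derivative_works] assms(2-5) by (rule curve_derivative)

lemma tangent_map_eq:
  assumes "(f has_derivative A) (at x within X)" "v \<in> tangent_space X x"
  shows "tangent_map X f x v = A v"
proof -
  from assms(2) obtain \<gamma> \<epsilon> where g: "\<epsilon> > 0" "\<gamma> ` {-\<epsilon><..<\<epsilon>} \<subseteq> X" "\<gamma> 0 = x"
      "(\<gamma> has_vector_derivative v) (at (0::real))"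
    unfolding tangent_space_def by blast
  have "f differentiable (at x within X)"
    using assms(1) unfolding differentiable_def by blast
  from tangent_map_curve[OF this g] curve_derivative[OF assms(1) g] show ?thesis
    by (rule vector_derivative_unique_at)
qed

lemma funpow_differentiable:
  assumes "C1_diffeo X f" "x \<in> X"
  shows "(f ^^ t) x \<in> X \<and> (f ^^ t) differentiable (at x within X)"
proof -
  have sub: "(f ^^ t) ` X \<subseteq> X" for t
    using assms(1) by (induction t) (auto simp: C1_diffeo_def bij_betw_def)
  have "(f ^^ t) differentiable (at x within X)"
  proof (induction t)
    case 0
    then show ?case by (simp add: id_def)
  next
    case (Suc t)
    have "f differentiable (at ((f ^^ t) x) within X)"
      using assms sub C1_map_differentiable unfolding C1_diffeo_def by blast
    then have "f differentiable (at ((f ^^ t) x) within ((f ^^ t) ` X))"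
      using sub differentiable_within_subset by blast
    then show ?case
      using differentiable_chain_within[OF Suc] by (simp add: comp_def)
  qed
  with sub assms(2) show ?thesis by blast
qed

lemma growth_le_iff:
  fixes A :: "nat \<Rightarrow> 'a::euclidean_space"
  shows "limsup (\<lambda>t. ereal (1 / real t) * ext_log (norm (A t))) \<le> l \<longleftrightarrow>
    (\<forall>r. l < ereal r \<longrightarrow> (\<forall>\<^sub>F t in sequentially. norm (A t) < exp (r * real t)))"
    (is "?L \<longleftrightarrow> ?R")
proof -
  have *: "ereal (1 / real t) * ext_log (norm (A t)) < ereal r \<longleftrightarrow> norm (A t) < exp (r * real t)"
    if "t > 0" for t r
  proof (cases "A t = 0")
    case True
    then show ?thesis using that by (simp add: ext_log_def)
  next
    case False
    then have "norm (A t) < exp (r * real t) \<longleftrightarrow> ln (norm (A t)) < r * real t"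
      by (metis exp_gt_zero exp_less_cancel_iff exp_ln zero_less_norm_iff)
    then show ?thesis using that False by (simp add: ext_log_def field_simps)
  qed
  have ev: "(\<forall>\<^sub>F t in sequentially. ereal (1 / real t) * ext_log (norm (A t)) < ereal r) \<longleftrightarrow>
      (\<forall>\<^sub>F t in sequentially. norm (A t) < exp (r * real t))" for r
    by (rule eventually_cong[OF eventually_gt_at_top[of 0]]) (use * in auto)
  show ?thesis
  proof
    assume ?L
    then show ?R unfolding Limsup_le_iff ev[symmetric] by blast
  next
    assume R: ?R
    show ?L unfolding Limsup_le_iff
    proof (intro allI impI)
      fix y :: ereal assume "l < y"
      then obtain r where r: "l < ereal r" "ereal r < y"
        using ereal_dense2 by blast
      from R r(1) have "\<forall>\<^sub>F t in sequentially. ereal (1 / real t) * ext_log (norm (A t)) < ereal r"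
        unfolding ev by blast
      then show "\<forall>\<^sub>F t in sequentially. ereal (1 / real t) * ext_log (norm (A t)) < y"
        by eventually_elim (use r(2) in auto)
    qed
  qed
qed

lemma exp_eventually_dominates:
  assumes "s < (r::real)"
  shows "\<forall>\<^sub>F t in sequentially. c * exp (s * real t) < exp (r * real t)"
proof -
  have "filterlim (\<lambda>t. exp ((r - s) * real t)) at_top sequentially"
    by (rule filterlim_compose[OF exp_at_top], rule filterlim_tendsto_pos_mult_at_top)
      (use assms in \<open>auto simp: filterlim_real_sequentially\<close>)
  then have "\<forall>\<^sub>F t in sequentially. c < exp ((r - s) * real t)"
    unfolding filterlim_at_top_dense by blast
  then show ?thesis
  proof eventually_elim
    case (elim t)
    then have "c * exp (s * real t) < exp ((r - s) * real t) * exp (s * real t)"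
      by (intro mult_strict_right_mono) auto
    then show ?case by (simp add: exp_add[symmetric] algebra_simps)
  qed
qed

lemma finite_growth_rates:
  fixes A :: "nat \<Rightarrow> 'a::euclidean_space \<Rightarrow> 'b::euclidean_space"
  assumes lin: "\<And>t. linear (A t)"
  shows "finite (range (\<lambda>v. limsup (\<lambda>t. ereal (1 / real t) * ext_log (norm (A t v)))))"
proof -
  define g where "g = (\<lambda>v. limsup (\<lambda>t. ereal (1 / real t) * ext_log (norm (A t v))))"
  define W where "W = (\<lambda>l. {v. g v \<le> l})"
  have iff: "v \<in> W l \<longleftrightarrow>
      (\<forall>r. l < ereal r \<longrightarrow> (\<forall>\<^sub>F t in sequentially. norm (A t v) < exp (r * real t)))" for v l
    unfolding W_def g_def using growth_le_iff by simp
  have sub: "subspace (W l)" for l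
  proof (rule subspaceI)
    show "0 \<in> W l"
      unfolding iff using lin by (simp add: linear_0)
  next
    fix v w assume vw: "v \<in> W l" "w \<in> W l"
    show "v + w \<in> W l"
      unfolding iff
    proof (intro allI impI)
      fix r assume "l < ereal r"
      then obtain s where s: "l < ereal s" "s < r"
        using ereal_dense2 by (metis less_ereal.simps(1))
      have "\<forall>\<^sub>F t in sequentially. 2 * exp (s * real t) < exp (r * real t)"
        using s(2) by (rule exp_eventually_dominates)
      moreover have "\<forall>\<^sub>F t in sequentially. norm (A t v) < exp (s * real t)"
        "\<forall>\<^sub>F t in sequentially. norm (A t w) < exp (s * real t)"
        using vw s(1) unfolding iff by blast+
      ultimately show "\<forall>\<^sub>F t in sequentially. norm (A t (v + w)) < exp (r * real t)"
      proof eventually_elim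
        case (elim t)
        have "norm (A t (v + w)) \<le> norm (A t v) + norm (A t w)"
          using lin[of t] by (simp add: linear_add norm_triangle_ineq)
        with elim show ?case by linarith
      qed
    qed
  next
    fix c v assume v: "v \<in> W l"
    show "c *\<^sub>R v \<in> W l"
      unfolding iff
    proof (intro allI impI)
      fix r assume "l < ereal r"
      then obtain s where s: "l < ereal s" "s < r"
        using ereal_dense2 by (metis less_ereal.simps(1))
      have "\<forall>\<^sub>F t in sequentially. \<bar>c\<bar> * exp (s * real t) < exp (r * real t)"
        using s(2) by (rule exp_eventually_dominates)
      moreover have "\<forall>\<^sub>F t in sequentially. norm (A t v) < exp (s * real t)"
        using v s(1) unfolding iff by blast
      ultimately show "\<forall>\<^sub>F t in sequentially. norm (A t (c *\<^sub>R v)) < exp (r * real t)"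
      proof eventually_elim
        case (elim t)
        have "norm (A t (c *\<^sub>R v)) = \<bar>c\<bar> * norm (A t v)"
          using lin[of t] by (simp add: linear_scale)
        also have "\<dots> \<le> \<bar>c\<bar> * exp (s * real t)"
          using elim by (intro mult_left_mono) auto
        finally show ?case using elim by linarith
      qed
    qed
  qed
  have less: "dim (W (g v)) < dim (W (g w))" if "g v < g w" for v w
  proof -
    have "w \<notin> W (g v)" "w \<in> W (g w)" "W (g v) \<subseteq> W (g w)"
      using that unfolding W_def by auto
    then have "W (g v) \<subset> W (g w)" by blast
    then show ?thesis using sub by (metis dim_psubset span_eq_iff)
  qed
  have "inj_on (\<lambda>l. dim (W l)) (range g)"
    by (rule inj_onI) (metis imageE less less_irrefl neqE)
  moreover have "(\<lambda>l. dim (W l)) ` range g \<subseteq> {..DIM('a)}"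
    using dim_subset_UNIV by blast
  ultimately have "finite (range g)"
    using finite_subset[OF _ finite_atMost] finite_imageD by metis
  then show ?thesis unfolding g_def .
qed

lemma largest_lyapunov_eq_Max:
  assumes "C1_diffeo X f" "x \<in> X"
  shows "finite (lyapunov_exponent X f x ` (tangent_space X x - {0}))"
    and "tangent_space X x - {0} \<noteq> {} \<Longrightarrow>
      largest_lyapunov X f x = Max (lyapunov_exponent X f x ` (tangent_space X x - {0}))"
proof -
  have "linear (frechet_derivative (f ^^ t) (at x within X))" for t
    using linear_frechet_derivative funpow_differentiable[OF assms] by blast
  from finite_growth_rates[OF this] have "finite (range (lyapunov_exponent X f x))"
    unfolding lyapunov_exponent_def tangent_map_def .
  then show *: "finite (lyapunov_exponent X f x ` (tangent_space X x - {0}))"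
    using finite_subset by (metis image_mono subset_UNIV)
  show "largest_lyapunov X f x = Max (lyapunov_exponent X f x ` (tangent_space X x - {0}))"
    if "tangent_space X x - {0} \<noteq> {}"
    unfolding largest_lyapunov_def using * that by (simp add: cSup_eq_Max)
qed

end

theory Submission
  imports Defs
begin

text \<open>
Unrolling the recursion gives
\<open>a\<^sub>t = (\<Sum>s=1..t. D\<Phi>\<^sup>t\<^sup>-\<^sup>s(x\<^sub>s) C\<^sub>s)\<close> (\<open>cocycle_sum_eq\<close>), so what has to be
bounded is the norm of the propagator from time \<open>s\<close> to time \<open>t\<close> along the orbit, uniformly
in \<open>s \<le> t\<close>, by a constant times \<open>exp (t * (\<lambda> + \<delta>))\<close> with \<open>\<lambda> = \<lambda>\<^sub>1\<^sup>p\<^sup>o\<^sup>s\<close>.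
For \<open>s = 0\<close> this is the definition of the Lyapunov exponent: for any rate \<open>c > \<lambda>\<close> there is a
finite constant \<open>R\<^sub>c(x)\<close> such that \<open>D\<Phi>\<^sup>n(x)\<close> is bounded by \<open>R\<^sub>c(x) * exp (c * n)\<close>
for all \<open>n\<close>. Starting at a later point \<open>x\<^sub>s\<close> replaces the constant by \<open>R\<^sub>c(x\<^sub>s)\<close>,
and the whole difficulty is to show that this grows subexponentially in \<open>s\<close> for almost
every \<open>x\<close>.

The reason for this is a maximal inequality. If \<open>M\<close> bounds \<open>D\<Phi>\<close> on the compact set \<open>X'\<close>, then \<open>R\<^sub>c(x) \<le> M * R\<^sub>c(\<Phi>(x))\<close>.
Hence \<open>log R\<^sub>c\<close> decreases by at most a constant in each step; if it were
larger than \<open>\<epsilon> * s\<close> at infinitely many times \<open>s\<close>, it would stay large during proportionally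
long stretches after them, and the orbit would visit the sets \<open>{N < R\<^sub>c < \<infinity>}\<close> with a
frequency bounded below independently of \<open>N\<close>. As these sets shrink to the empty set, the
maximal ergodic inequality allows this only on a null set. This is \<open>AE_tempered\<close>.

All of this needs \<open>R\<^sub>c\<close> to be measurable. This is why operator norms on tangent
spaces are replaced by local Lipschitz constants of the iterates on \<open>X\<close>: these are submultiplicative, bound the tangent
maps (\<open>lipschitz_near_tangent_map_le\<close>), and are admissible on open sets. The submanifold structure
enters only through \<open>lipschitz_near_of_tangent_bound\<close>, the converse estimate, which makes
\<open>R\<^sub>c(x)\<close> finite for \<open>c > \<lambda>\<close> (\<open>growth_level_of_lyapunov\<close>).
\<close>

section \<open>Local Lipschitz constants and strict derivatives\<close>

text \<open>The estimate holds on a whole neighbourhood. Therefore the set of points at which a given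
constant is admissible is open, whatever the map, and in particular it is Borel.\<close>

definition lipschitz_near ::
    "'a::metric_space set \<Rightarrow> ('a \<Rightarrow> 'b::metric_space) \<Rightarrow> 'a \<Rightarrow> real \<Rightarrow> bool" where
  "lipschitz_near X f x c \<longleftrightarrow> (\<exists>U. open U \<and> x \<in> U \<and> c-lipschitz_on (X \<inter> U) f)"

lemma lipschitz_near_mono:
  assumes "lipschitz_near X f x c" "c \<le> d" "Y \<subseteq> X"
  shows "lipschitz_near Y f x d"
proof -
  obtain U where U: "open U" "x \<in> U" "c-lipschitz_on (X \<inter> U) f"
    using assms(1) unfolding lipschitz_near_def by blast
  have "d-lipschitz_on (Y \<inter> U) f"
    by (rule lipschitz_on_mono[OF U(3)]) (use assms in auto)
  with U show ?thesis unfolding lipschitz_near_def by blast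
qed

lemma open_lipschitz_near: "open {x. lipschitz_near X f x c}"
proof -
  have "{x. lipschitz_near X f x c} = \<Union>{U. open U \<and> c-lipschitz_on (X \<inter> U) f}"
    unfolding lipschitz_near_def by auto
  then show ?thesis by auto
qed

lemma lipschitz_near_compose:
  assumes f: "lipschitz_near X f x c" and g: "lipschitz_near Y g (f x) d"
    and W: "x \<in> X" "open W" "x \<in> W" "f ` (X \<inter> W) \<subseteq> Y"
  shows "lipschitz_near X (\<lambda>y. g (f y)) x (d * c)"
proof -
  obtain U where U: "open U" "x \<in> U" "c-lipschitz_on (X \<inter> U) f"
    using f unfolding lipschitz_near_def by blast
  obtain V where V: "open V" "f x \<in> V" "d-lipschitz_on (Y \<inter> V) g"
    using g unfolding lipschitz_near_def by blast
  obtain A where A: "open A" "A \<inter> (X \<inter> U) = f -` V \<inter> (X \<inter> U)"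
    using lipschitz_on_continuous_on[OF U(3)] V(1) unfolding continuous_on_open_invariant
    by blast
  let ?N = "A \<inter> U \<inter> W"
  have "f ` (X \<inter> ?N) \<subseteq> Y \<inter> V"
    using A(2) W(4) by blast
  then have "d-lipschitz_on (f ` (X \<inter> ?N)) g"
    using V(3) lipschitz_on_subset by blast
  moreover have "c-lipschitz_on (X \<inter> ?N) f"
    using U(3) by (rule lipschitz_on_subset) blast
  ultimately have "(d * c)-lipschitz_on (X \<inter> ?N) (\<lambda>y. g (f y))"
    by (intro lipschitz_on_compose2)
  moreover have "x \<in> ?N" using A(2) U(2) V(2) W by blast
  moreover have "open ?N" using A(1) U(1) W(2) by auto
  ultimately show ?thesis
    unfolding lipschitz_near_def by (intro exI[of _ ?N] conjI)
qed

lemma lipschitz_near_add: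
  fixes f g :: "'a::metric_space \<Rightarrow> 'b::real_normed_vector"
  assumes "lipschitz_near X f x c" "lipschitz_near X g x d"
  shows "lipschitz_near X (\<lambda>y. f y + g y) x (c + d)"
proof -
  obtain U V where "open U" "x \<in> U" "c-lipschitz_on (X \<inter> U) f"
    "open V" "x \<in> V" "d-lipschitz_on (X \<inter> V) g"
    using assms unfolding lipschitz_near_def by blast
  moreover from this have "(c + d)-lipschitz_on (X \<inter> (U \<inter> V)) (\<lambda>y. f y + g y)"
    by (intro lipschitz_on_add; elim lipschitz_on_subset) auto
  ultimately show ?thesis
    unfolding lipschitz_near_def by (metis IntI open_Int)
qed

lemma lipschitz_near_linear:
  assumes "linear A" "subspace S" "0 \<le> B" "\<And>s. s \<in> S \<Longrightarrow> norm (A s) \<le> B * norm s"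
  shows "lipschitz_near S A x B"
proof -
  have "B-lipschitz_on S A"
  proof (rule lipschitz_onI)
    fix y z assume "y \<in> S" "z \<in> S"
    then show "dist (A y) (A z) \<le> B * dist y z"
      using assms(4)[of "y - z"] subspace_diff[OF assms(2)] linear_diff[OF assms(1)]
      by (simp add: dist_norm)
  qed fact
  then show ?thesis unfolding lipschitz_near_def by (intro exI[of _ UNIV]) simp
qed

lemma lipschitz_near_bounded_linear:
  assumes "bounded_linear A"
  shows "lipschitz_near X A x (onorm A)"
proof -
  have "lipschitz_near UNIV A x (onorm A)"
    using assms
    by (intro lipschitz_near_linear)
      (auto intro: bounded_linear.linear onorm onorm_pos_le)
  then show ?thesis by (rule lipschitz_near_mono) auto
qed

lemma lipschitz_near_transform:
  assumes "lipschitz_near X f x c" "open W" "x \<in> W" "\<And>y. y \<in> X \<inter> W \<Longrightarrow> g y = f y"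
  shows "lipschitz_near X g x c"
proof -
  obtain U where U: "open U" "x \<in> U" "c-lipschitz_on (X \<inter> U) f"
    using assms unfolding lipschitz_near_def by blast
  have "c-lipschitz_on (X \<inter> (U \<inter> W)) f"
    using U(3) by (rule lipschitz_on_subset) blast
  then have "c-lipschitz_on (X \<inter> (U \<inter> W)) g"
    by (rule lipschitz_on_transform) (use assms(4) in auto)
  then show ?thesis
    unfolding lipschitz_near_def using U(1,2) assms(2,3) by blast
qed

text \<open>The classical strict (or strong) derivative relative to \<open>X\<close>: the remainder
\<open>f - D\<close> has arbitrarily small Lipschitz constants near \<open>x\<close>.
It keeps of a \<open>C\<^sup>1\<close> extension exactly what is needed at one point, and unlike the
existence of an extension it is inherited by compositions without any shrinking of domains.\<close>

definition strict_derivative ::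
    "'a::real_normed_vector set \<Rightarrow> ('a \<Rightarrow> 'b::real_normed_vector) \<Rightarrow> ('a \<Rightarrow> 'b) \<Rightarrow> 'a \<Rightarrow> bool"
  where "strict_derivative X f D x \<longleftrightarrow>
    bounded_linear D \<and> (\<forall>e>0. lipschitz_near X (\<lambda>y. f y - D y) x e)"

lemma strict_derivative_lipschitz_near:
  assumes "strict_derivative X f D x" "e > 0"
  shows "lipschitz_near X f x (e + onorm D)"
proof -
  have "lipschitz_near X (\<lambda>y. (f y - D y) + D y) x (e + onorm D)"
    using assms unfolding strict_derivative_def
    by (intro lipschitz_near_add lipschitz_near_bounded_linear) auto
  then show ?thesis by simp
qed

lemma strict_derivative_has_derivative:
  assumes "strict_derivative X f D x" "x \<in> X"
  shows "(f has_derivative D) (at x within X)"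
  unfolding has_derivative_within_alt
proof (intro conjI allI impI)
  show "bounded_linear D" using assms unfolding strict_derivative_def by blast
  interpret bounded_linear D by fact
  fix e :: real assume "e > 0"
  then obtain U where U: "open U" "x \<in> U" "e-lipschitz_on (X \<inter> U) (\<lambda>y. f y - D y)"
    using assms(1) unfolding strict_derivative_def lipschitz_near_def by blast
  obtain d where d: "d > 0" "ball x d \<subseteq> U" using U openE by blast
  have "norm (f y - f x - D (y - x)) \<le> e * norm (y - x)" if "y \<in> X" "norm (y - x) < d" for y
  proof -
    have "y \<in> U" using that d by (auto simp: dist_norm norm_minus_commute subset_iff)
    then show ?thesis
      using lipschitz_on_normD[OF U(3), of y x] that(1) U(2) assms(2) by (simp add: diff algebra_simps)
  qed
  then show "\<exists>d>0. \<forall>y\<in>X. norm (y - x) < d \<longrightarrow> norm (f y - f x - D (y - x)) \<le> e * norm (y - x)"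
    using d(1) by blast
qed

text \<open>The remainder of a composition splits as
\<open>g \<circ> f - E \<circ> D = (g - E) \<circ> f + E \<circ> (f - D)\<close>, and both
terms have small Lipschitz constants.\<close>

lemma strict_derivative_compose:
  assumes f: "strict_derivative X f D x" and g: "strict_derivative X g E (f x)"
    and X: "x \<in> X" "f ` X \<subseteq> X"
  shows "strict_derivative X (\<lambda>y. g (f y)) (\<lambda>v. E (D v)) x"
  unfolding strict_derivative_def
proof (intro conjI allI impI)
  have lin: "bounded_linear D" "bounded_linear E"
    using f g unfolding strict_derivative_def by auto
  then show "bounded_linear (\<lambda>v. E (D v))" using bounded_linear_compose by blast
  fix e :: real assume e: "e > 0"
  \<comment> \<open>The tolerances are chosen so that each of the two terms contributes at most e / 2.\<close>
  define a where "a = e / (2 * (1 + onorm D))"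
  define b where "b = e / (2 * (1 + onorm E))"
  have pos: "onorm D \<ge> 0" "onorm E \<ge> 0" using lin onorm_pos_le by auto
  have ab: "a > 0" "b > 0" unfolding a_def b_def using e pos by auto
  have "lipschitz_near X f x (1 + onorm D)"
    using strict_derivative_lipschitz_near[OF f, of 1] by simp
  moreover have "lipschitz_near X (\<lambda>y. g y - E y) (f x) a"
    using g ab unfolding strict_derivative_def by blast
  ultimately have 1: "lipschitz_near X (\<lambda>y. g (f y) - E (f y)) x (a * (1 + onorm D))"
    by (rule lipschitz_near_compose[OF _ _ X(1) open_UNIV]) (use X(2) in auto)
  have "lipschitz_near X (\<lambda>y. f y - D y) x b"
    using f ab unfolding strict_derivative_def by blast
  from lipschitz_near_compose[OF this lipschitz_near_bounded_linear[OF lin(2)] X(1) open_UNIV]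
  have 2: "lipschitz_near X (\<lambda>y. E (f y - D y)) x (onorm E * b)"
    by auto
  have "lipschitz_near X (\<lambda>y. (g (f y) - E (f y)) + E (f y - D y)) x
      (a * (1 + onorm D) + onorm E * b)"
    using 1 2 by (rule lipschitz_near_add)
  then have "lipschitz_near X (\<lambda>y. g (f y) - E (D y)) x (a * (1 + onorm D) + onorm E * b)"
    using bounded_linear.linear[OF lin(2)] by (simp add: linear_diff)
  moreover have "a * (1 + onorm D) = e / 2" unfolding a_def using pos by (simp add: field_simps)
  moreover have "onorm E * b \<le> e / 2" unfolding b_def using pos e by (simp add: field_simps)
  ultimately show "lipschitz_near X (\<lambda>y. g (f y) - E (D y)) x e"
    by (elim lipschitz_near_mono) auto
qed

text \<open>On a small ball around \<open>x\<close> the derivative \<open>f' y - f' x\<close> of the remainder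
has small operator norm, so the mean value inequality on the (convex) ball applies.\<close>

lemma continuous_derivative_imp_strict:
  fixes f' :: "'a::real_normed_vector \<Rightarrow> 'a \<Rightarrow>\<^sub>L 'b::real_normed_vector"
  assumes "open U" "x \<in> U" "\<And>y. y \<in> U \<Longrightarrow> (f has_derivative blinfun_apply (f' y)) (at y)"
    "continuous_on U f'"
  shows "strict_derivative UNIV f (blinfun_apply (f' x)) x"
  unfolding strict_derivative_def
proof (intro conjI allI impI)
  show "bounded_linear (blinfun_apply (f' x))" by (rule blinfun.bounded_linear_right)
  fix e :: real assume "e > 0"
  then obtain d where d: "d > 0" "\<And>y. y \<in> U \<Longrightarrow> dist y x < d \<Longrightarrow> dist (f' y) (f' x) < e"
    using assms(2,4) unfolding continuous_on_iff by blast
  obtain d' where d': "d' > 0" "ball x d' \<subseteq> U" using assms(1,2) openE by blast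
  define r where "r = min d d'"
  have r: "r > 0" "ball x r \<subseteq> U" using d d' unfolding r_def by auto
  have "e-lipschitz_on (ball x r) (\<lambda>y. f y - f' x y)"
  proof (rule bounded_derivative_imp_lipschitz)
    fix y assume y: "y \<in> ball x r"
    then have "y \<in> U" using r by blast
    from assms(3)[OF this]
    have "((\<lambda>y. f y - f' x y) has_derivative (\<lambda>v. f' y v - f' x v)) (at y)"
      by (intro has_derivative_diff bounded_linear_imp_has_derivative
          blinfun.bounded_linear_right)
    then have "((\<lambda>y. f y - f' x y) has_derivative (\<lambda>v. f' y v - f' x v)) (at y within ball x r)"
      by (rule has_derivative_at_withinI)
    then show "((\<lambda>y. f y - f' x y) has_derivative blinfun_apply (f' y - f' x))
        (at y within ball x r)"
      by (simp add: minus_blinfun.rep_eq)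
    show "onorm (blinfun_apply (f' y - f' x)) \<le> e"
      using d(2)[OF \<open>y \<in> U\<close>] y unfolding r_def norm_blinfun.rep_eq[symmetric]
      by (simp add: dist_norm norm_minus_commute)
  qed (use \<open>e > 0\<close> in auto)
  then show "lipschitz_near UNIV (\<lambda>y. f y - f' x y) x e"
    unfolding lipschitz_near_def using r(1)
    by (intro exI[of _ "ball x r"]) auto
qed

lemma C1_map_strict_derivative:
  assumes "C1_map X f" "x \<in> X"
  shows "\<exists>D. strict_derivative X f D x"
proof -
  obtain U F where U: "x \<in> U" "C1_on U F" and eq: "\<forall>y\<in>X \<inter> U. F y = f y"
    using assms unfolding C1_map_def by blast
  obtain F' where F': "open U" "\<forall>y\<in>U. (F has_derivative blinfun_apply (F' y)) (at y)"
      "continuous_on U F'"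
    using U(2) unfolding C1_on_def by blast
  have "strict_derivative UNIV F (blinfun_apply (F' x)) x"
    using F' U(1) by (intro continuous_derivative_imp_strict) auto
  then have F: "strict_derivative X F (blinfun_apply (F' x)) x"
    unfolding strict_derivative_def using lipschitz_near_mono[OF _ order_refl subset_UNIV] by blast
  have "lipschitz_near X (\<lambda>y. f y - F' x y) x e" if "e > 0" for e
  proof (rule lipschitz_near_transform)
    show "lipschitz_near X (\<lambda>y. F y - F' x y) x e"
      using F that unfolding strict_derivative_def by blast
  qed (use U F'(1) eq in auto)
  then have "strict_derivative X f (blinfun_apply (F' x)) x"
    unfolding strict_derivative_def using blinfun.bounded_linear_right by blast
  then show ?thesis by blast
qed

section \<open>Growth on the tangent space controls local Lipschitz constants\<close>

text \<open>Of a chart only the following is kept: a Lipschitz coordinate map \<open>\<phi>\<close> into a linear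
space \<open>S\<close>, a strictly differentiable parametrisation \<open>\<psi>\<close>, and the fact that the
derivative \<open>P\<close> of the parametrisation sends \<open>S\<close> to tangent vectors. The latter
are the velocities of the images under \<open>\<psi>\<close> of straight lines in \<open>S\<close>.\<close>

lemma submanifold_chart:
  assumes "C1_submanifold q X" "x \<in> X"
  obtains S :: "'a::euclidean_space set" and P :: "'a \<Rightarrow> 'a" and \<phi> \<psi> :: "'a \<Rightarrow> 'a" and U c
  where "subspace S" "\<And>s. s \<in> S \<Longrightarrow> P s \<in> tangent_space X x"
    "open U" "x \<in> U" "\<And>y. y \<in> X \<inter> U \<Longrightarrow> \<phi> y \<in> S \<and> \<psi> (\<phi> y) = y"
    "lipschitz_near X \<phi> x c" "c > 0" "strict_derivative UNIV \<psi> P (\<phi> x)"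
proof -
  obtain U V \<phi> \<psi> S where C: "x \<in> U" "C1_on U (\<phi> :: 'a \<Rightarrow> 'a)" "C1_on V (\<psi> :: 'a \<Rightarrow> 'a)"
      "homeomorphism U V \<phi> \<psi>" "subspace S" "dim S = q" "\<phi> ` (X \<inter> U) = V \<inter> S"
    using assms unfolding C1_submanifold_def by blast
  obtain \<phi>' where p: "open U" "\<forall>y\<in>U. (\<phi> has_derivative blinfun_apply (\<phi>' y)) (at y)"
      "continuous_on U \<phi>'"
    using C(2) unfolding C1_on_def by blast
  obtain \<psi>' where s: "open V" "\<forall>y\<in>V. (\<psi> has_derivative blinfun_apply (\<psi>' y)) (at y)"
      "continuous_on V \<psi>'"
    using C(3) unfolding C1_on_def by blast
  let ?a = "\<phi> x"
  have a: "?a \<in> V" "?a \<in> S" "\<psi> ?a = x"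
    using C(1,4,7) assms(2) unfolding homeomorphism_def by auto
  have inv: "\<phi> y \<in> S \<and> \<psi> (\<phi> y) = y" if "y \<in> X \<inter> U" for y
    using that C(4,7) unfolding homeomorphism_def by auto
  have "strict_derivative UNIV \<phi> (blinfun_apply (\<phi>' x)) x"
    using p C(1) by (intro continuous_derivative_imp_strict) auto
  from strict_derivative_lipschitz_near[OF this, of 1]
  have lip: "lipschitz_near X \<phi> x (1 + onorm (blinfun_apply (\<phi>' x)))"
    using lipschitz_near_mono[OF _ order_refl subset_UNIV] by auto
  have sd: "strict_derivative UNIV \<psi> (blinfun_apply (\<psi>' ?a)) ?a"
    using s a by (intro continuous_derivative_imp_strict) auto
  have tan: "\<psi>' ?a w \<in> tangent_space X x" if w: "w \<in> S" for w
  proof -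
    define \<gamma> where "\<gamma> = (\<lambda>t. \<psi> (?a + t *\<^sub>R w))"
    have "open ((\<lambda>t. ?a + t *\<^sub>R w) -` V)"
      using s(1) by (intro open_vimage) (auto intro!: continuous_intros)
    moreover have "0 \<in> (\<lambda>t. ?a + t *\<^sub>R w) -` V" using a by simp
    ultimately obtain \<epsilon> where e: "\<epsilon> > 0" "ball 0 \<epsilon> \<subseteq> (\<lambda>t. ?a + t *\<^sub>R w) -` V"
      using openE by blast
    have V: "?a + t *\<^sub>R w \<in> V" if "t \<in> {-\<epsilon><..<\<epsilon>}" for t
      using e(2) that by (auto simp: ball_eq_greaterThanLessThan subset_iff)
    have der: "(\<gamma> has_vector_derivative \<psi>' (?a + t *\<^sub>R w) w) (at t)" if "t \<in> {-\<epsilon><..<\<epsilon>}" for t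
    proof -
      have "((\<lambda>t. ?a + t *\<^sub>R w) has_derivative (\<lambda>h. h *\<^sub>R w)) (at t)"
        by (auto intro!: derivative_eq_intros)
      from has_derivative_compose[OF this bspec[OF s(2) V[OF that]]] show ?thesis
        unfolding has_vector_derivative_def \<gamma>_def by (simp add: blinfun.scaleR_right)
    qed
    have "\<gamma> C1_differentiable_on {-\<epsilon><..<\<epsilon>}"
      unfolding C1_differentiable_on_def
    proof (intro exI conjI ballI)
      show "continuous_on {-\<epsilon><..<\<epsilon>} (\<lambda>t. \<psi>' (?a + t *\<^sub>R w) w)"
        using V by (intro continuous_intros continuous_on_compose2[OF s(3)]) auto
    qed (rule der)
    moreover have "\<gamma> ` {-\<epsilon><..<\<epsilon>} \<subseteq> X"
    proof (rule image_subsetI)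
      fix t assume "t \<in> {-\<epsilon><..<\<epsilon>}"
      then have "?a + t *\<^sub>R w \<in> V \<inter> S"
        using V a(2) w C(5) by (auto intro: subspace_add subspace_scale)
      then obtain y where y: "y \<in> X \<inter> U" "?a + t *\<^sub>R w = \<phi> y"
        using C(7) by (metis imageE)
      then show "\<gamma> t \<in> X" unfolding \<gamma>_def using inv[OF y(1)] by simp
    qed
    moreover have "\<gamma> 0 = x" unfolding \<gamma>_def using a by simp
    moreover have "(\<gamma> has_vector_derivative \<psi>' ?a w) (at 0)"
      using der[of 0] e(1) by simp
    ultimately show ?thesis unfolding tangent_space_def using e(1) by blast
  qed
  have pos: "1 + onorm (blinfun_apply (\<phi>' x)) > 0"
    using onorm_pos_le[OF blinfun.bounded_linear_right, of "\<phi>' x"] by linarith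
  show ?thesis by (rule that[OF C(5) tan p(1) C(1) inv lip pos sd])
qed

text \<open>Near \<open>x\<close> one has \<open>f = (f - D) + D \<circ> (\<psi> - P) \<circ> \<phi> + D \<circ> P \<circ> \<phi>\<close> on \<open>X\<close>.
The first two summands have arbitrarily small Lipschitz constants, and the last one is controlled by
the size of \<open>D\<close> on tangent vectors. The point of the lemma is that
\<open>S\<close>, \<open>P\<close> and \<open>c\<close> depend on \<open>x\<close> alone, so that it can be
applied to all iterates of a diffeomorphism with one and the same constant.\<close>

lemma lipschitz_near_of_tangent_bound:
  fixes X :: "'a::euclidean_space set"
  assumes "C1_submanifold q X" "x \<in> X"
  obtains S :: "'a set" and P :: "'a \<Rightarrow> 'a" and c :: real
  where "subspace S" "linear P" "\<And>s. s \<in> S \<Longrightarrow> P s \<in> tangent_space X x" "c > 0"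
    "\<And>(f :: 'a \<Rightarrow> 'a) D B. strict_derivative X f D x \<Longrightarrow> B > 0 \<Longrightarrow>
      (\<And>s. s \<in> S \<Longrightarrow> norm (D (P s)) \<le> B * norm s) \<Longrightarrow> lipschitz_near X f x (c * B)"
proof -
  obtain S P and \<phi> \<psi> :: "'a \<Rightarrow> 'a" and U c where
    C: "subspace S" "\<And>s. s \<in> S \<Longrightarrow> P s \<in> tangent_space X x"
    "open U" "x \<in> U" "\<And>y. y \<in> X \<inter> U \<Longrightarrow> \<phi> y \<in> S \<and> \<psi> (\<phi> y) = y"
    "lipschitz_near X \<phi> x c" "c > 0" "strict_derivative UNIV \<psi> P (\<phi> x)"
    by (rule submanifold_chart[OF assms]) (rule that)
  have linP: "linear P"
    using C(8) bounded_linear.linear unfolding strict_derivative_def by blast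
  have lip: "lipschitz_near X f x (2 * c * B)"
    if f: "strict_derivative X f D x" and B: "B > 0"
      and bnd: "\<And>s. s \<in> S \<Longrightarrow> norm (D (P s)) \<le> B * norm s" for f :: "'a \<Rightarrow> 'a" and D B
  proof -
    have D: "bounded_linear D" using f unfolding strict_derivative_def by blast
    \<comment> \<open>Tolerances for the first two summands: each contributes at most B * c / 2.\<close>
    define e where "e = B * c / 2"
    define e' where "e' = B / (2 * (1 + onorm D))"
    have pos: "onorm D \<ge> 0" using D onorm_pos_le by auto
    have ee: "e > 0" "e' > 0" unfolding e_def e'_def using B C(7) pos by auto
    have UU: "\<phi> ` (X \<inter> U) \<subseteq> S" using C(5) by blast
    have 1: "lipschitz_near X (\<lambda>y. f y - D y) x e"
      using f ee unfolding strict_derivative_def by blast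
    have "lipschitz_near UNIV (\<lambda>y. \<psi> y - P y) (\<phi> x) e'"
      using C(8) ee unfolding strict_derivative_def by blast
    from lipschitz_near_compose[OF C(6) this assms(2) C(3,4) subset_UNIV]
    have "lipschitz_near X (\<lambda>y. \<psi> (\<phi> y) - P (\<phi> y)) x (e' * c)" .
    from lipschitz_near_compose[OF this lipschitz_near_bounded_linear[OF D] assms(2) C(3,4) subset_UNIV]
    have 2: "lipschitz_near X (\<lambda>y. D (\<psi> (\<phi> y) - P (\<phi> y))) x (onorm D * (e' * c))" .
    have "lipschitz_near S (\<lambda>s. D (P s)) (\<phi> x) B"
      using linear_compose[OF linP bounded_linear.linear[OF D]] C(1) B bnd
      by (intro lipschitz_near_linear) (auto simp: o_def)
    from lipschitz_near_compose[OF C(6) this assms(2) C(3,4) UU]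
    have 3: "lipschitz_near X (\<lambda>y. D (P (\<phi> y))) x (B * c)" .
    have "lipschitz_near X
        (\<lambda>y. (f y - D y) + D (\<psi> (\<phi> y) - P (\<phi> y)) + D (P (\<phi> y))) x (e + onorm D * (e' * c) + B * c)"
      by (rule lipschitz_near_add[OF lipschitz_near_add[OF 1 2] 3])
    then have "lipschitz_near X f x (e + onorm D * (e' * c) + B * c)"
      using C(3,4)
    proof (rule lipschitz_near_transform)
      fix y assume "y \<in> X \<inter> U"
      then have "\<psi> (\<phi> y) = y" using C(5) by blast
      then show "f y = (f y - D y) + D (\<psi> (\<phi> y) - P (\<phi> y)) + D (P (\<phi> y))"
        using bounded_linear.linear[OF D] by (simp add: linear_diff)
    qed
    moreover have "onorm D * (e' * c) \<le> B * c / 2"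
    proof -
      have "onorm D * e' \<le> B / 2" unfolding e'_def using pos B by (simp add: field_simps)
      then show ?thesis using C(7) mult_right_mono[of "onorm D * e'" "B / 2" c] by simp
    qed
    ultimately show ?thesis
      by (elim lipschitz_near_mono) (auto simp: e_def mult.commute)
  qed
  show ?thesis
  proof (rule that[OF C(1) linP C(2)])
    show "2 * c > 0" using C(7) by simp
  qed (use lip in blast)+
qed

text \<open>Conversely, a local Lipschitz constant bounds the speed of the image of any curve in \<open>X\<close>
by the speed of the curve itself.\<close>

lemma lipschitz_near_tangent_map_le:
  assumes "lipschitz_near X f x c" "f differentiable (at x within X)" "v \<in> tangent_space X x"
  shows "norm (tangent_map X f x v) \<le> c * norm v"
proof -
  obtain \<gamma> \<epsilon> where g: "\<epsilon> > 0" "\<gamma> ` {-\<epsilon><..<\<epsilon>} \<subseteq> X" "\<gamma> 0 = x"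
      "(\<gamma> has_vector_derivative v) (at (0::real))"
    using assms(3) unfolding tangent_space_def by blast
  obtain U where U: "open U" "x \<in> U" "c-lipschitz_on (X \<inter> U) f"
    using assms(1) unfolding lipschitz_near_def by blast
  have lim: "((\<lambda>h. norm (g h - g 0) / norm h) \<longlongrightarrow> norm w) (at 0)"
    if "(g has_vector_derivative w) (at (0::real))" for g :: "real \<Rightarrow> 'c::real_normed_vector" and w
  proof -
    have "((\<lambda>h. norm (g h - g 0 - h *\<^sub>R w) / norm h) \<longlongrightarrow> 0) (at 0)"
      using that unfolding has_vector_derivative_def has_derivative_at by simp
    moreover have "norm (g h - g 0 - h *\<^sub>R w) / norm h = norm ((g h - g 0) /\<^sub>R h - w)" if "h \<noteq> 0" for h
    proof -
      have "g h - g 0 - h *\<^sub>R w = h *\<^sub>R ((g h - g 0) /\<^sub>R h - w)"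
        using that by (simp add: scaleR_diff_right)
      then show ?thesis using that by simp
    qed
    ultimately have "((\<lambda>h. norm ((g h - g 0) /\<^sub>R h - w)) \<longlongrightarrow> 0) (at 0)"
      by (elim Lim_transform_eventually) (auto simp: eventually_at_filter)
    then have "((\<lambda>h. norm ((g h - g 0) /\<^sub>R h)) \<longlongrightarrow> norm w) (at 0)"
      by (intro tendsto_norm) (simp add: tendsto_norm_zero_iff LIM_zero_cancel)
    then show ?thesis by (simp add: divide_inverse mult.commute)
  qed
  have 1: "((\<lambda>h. norm ((f \<circ> \<gamma>) h - (f \<circ> \<gamma>) 0) / norm h) \<longlongrightarrow> norm (tangent_map X f x v)) (at 0)"
    by (rule lim[OF tangent_map_curve[OF assms(2) g]])
  have 2: "((\<lambda>h. c * (norm (\<gamma> h - \<gamma> 0) / norm h)) \<longlongrightarrow> c * norm v) (at 0)"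
    by (intro tendsto_intros lim g)
  have "isCont \<gamma> 0" using g(4) by (rule has_vector_derivative_continuous)
  then have "\<forall>\<^sub>F h in at 0. \<gamma> h \<in> U"
    unfolding isCont_def using U(1,2) g(3) by (auto dest: topological_tendstoD)
  moreover have "\<forall>\<^sub>F h in at (0::real). h \<in> {-\<epsilon><..<\<epsilon>}"
    using g(1) by (intro eventually_at_in_open') auto
  ultimately have "\<forall>\<^sub>F h in at 0. norm ((f \<circ> \<gamma>) h - (f \<circ> \<gamma>) 0) / norm h \<le>
      c * (norm (\<gamma> h - \<gamma> 0) / norm h)"
  proof eventually_elim
    case (elim h)
    then have "\<gamma> h \<in> X \<inter> U" "\<gamma> 0 \<in> X \<inter> U" using g(1,2,3) U(2) by (auto simp: image_subset_iff)
    from lipschitz_on_normD[OF U(3) this] show ?case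
      by (simp add: divide_right_mono)
  qed
  from tendsto_le[OF _ 2 1 this] show ?thesis by simp
qed

section \<open>A maximal inequality and tempered level sets\<close>

lemma AE_funpow:
  assumes T: "T \<in> measurable M M" "distr M M T = M" and P: "AE x in M. P x"
  shows "AE x in M. P ((T ^^ n) x)"
proof (induction n)
  case 0
  then show ?case using P by simp
next
  case (Suc n)
  have "AE x in distr M M T. P ((T ^^ n) x)" unfolding T(2) by (rule Suc)
  then have "AE x in M. P ((T ^^ n) (T x))"
    by (rule AE_distrD[OF T(1)])
  then show ?case by (simp add: funpow_swap1)
qed

text \<open>The set of points whose orbit visits \<open>B\<close> during some initial stretch with frequency
greater than \<open>\<alpha>\<close> has measure at most \<open>measure M B / \<alpha>\<close>. The proof is
Garsia's, for the function \<open>f = indicator B - \<alpha>\<close>: the maximal partial sums \<open>m N\<close>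
satisfy \<open>m N - m N \<circ> T \<le> f\<close> on \<open>{m N > 0}\<close>, and
the left-hand side is nonpositive elsewhere and integrates to 0.\<close>

lemma maximal_ergodic_inequality:
  fixes M :: "'a measure" and T :: "'a \<Rightarrow> 'a" and \<alpha> :: real
  assumes "prob_space M" and T [measurable]: "T \<in> measurable M M" and inv: "distr M M T = M"
    and B [measurable]: "B \<in> sets M" and \<alpha>: "\<alpha> > 0"
  shows "\<exists>E\<in>sets M. \<alpha> * measure M E \<le> measure M B \<and>
    {x \<in> space M. \<exists>n. (\<Sum>i<n. indicator B ((T ^^ i) x) - \<alpha>) > 0} \<subseteq> E"
proof -
  interpret prob_space M by fact
  define f where "f = (\<lambda>x. indicator B x - \<alpha>)"
  define m where "m = rec_nat (\<lambda>x. 0::real) (\<lambda>_ g x. max 0 (f x + g (T x)))"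
  \<comment> \<open>m N is the maximum of 0 and the first N partial sums of f along the orbit.\<close>
  have m0: "m 0 = (\<lambda>x. 0)" and mS: "m (Suc N) = (\<lambda>x. max 0 (f x + m N (T x)))" for N
    unfolding m_def by simp_all
  have fm [measurable]: "f \<in> borel_measurable M" unfolding f_def by measurable
  have mm [measurable]: "m N \<in> borel_measurable M" for N
  proof (induction N)
    case (Suc N)
    note Suc [measurable]
    show ?case unfolding mS by measurable
  qed (simp add: m0)
  have nonneg: "0 \<le> m N x" for N x by (cases N) (auto simp: m0 mS)
  have mono: "m N x \<le> m (Suc N) x" for N x
  proof (induction N arbitrary: x)
    case (Suc N)
    then show ?case unfolding mS[of "Suc N"] mS[of N] by (intro max.mono) auto
  qed (simp add: m0 nonneg)
  have bound: "m N x \<le> real N" for N x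
  proof (induction N arbitrary: x)
    case (Suc N)
    have "f x \<le> 1" unfolding f_def using \<alpha> by (simp split: split_indicator)
    then show ?case unfolding mS using Suc[of "T x"] by simp
  qed (simp add: m0)
  have S_le: "(\<Sum>i<n. f ((T ^^ i) x)) \<le> m n x" for n x
  proof (induction n arbitrary: x)
    case (Suc n)
    have "(\<Sum>i<Suc n. f ((T ^^ i) x)) = f x + (\<Sum>i<n. f ((T ^^ i) (T x)))"
      by (subst sum.lessThan_Suc_shift) (simp add: funpow_swap1)
    then show ?case unfolding mS using Suc[of "T x"] by simp
  qed (simp add: m0)
  define E where "E = (\<lambda>N. {x \<in> space M. m N x > 0})"
  have E [measurable]: "E N \<in> sets M" for N unfolding E_def by measurable
  have le: "\<alpha> * measure M (E N) \<le> measure M B" for N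
  proof -
    have int_m: "integrable M (m N)"
      by (rule integrable_const_bound[where B="real N"]) (use nonneg bound in auto)
    have int_mT: "integrable M (\<lambda>x. m N (T x))"
      by (rule integrable_const_bound[where B="real N"]) (use nonneg bound in auto)
    have eq: "(\<integral>x. m N (T x) \<partial>M) = (\<integral>x. m N x \<partial>M)"
      using integral_distr[OF T mm, of N] unfolding inv by simp
    have int_f: "integrable M (\<lambda>x. indicator B x * indicator (E N) x - \<alpha> * indicator (E N) x :: real)"
      by (rule integrable_const_bound[where B="1 + \<alpha>"]) (use \<alpha> in \<open>auto split: split_indicator\<close>)
    have "0 = (\<integral>x. m N x - m N (T x) \<partial>M)"
      using int_m int_mT eq by simp
    also have "\<dots> \<le> (\<integral>x. indicator B x * indicator (E N) x - \<alpha> * indicator (E N) x \<partial>M)"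
    proof (rule integral_mono)
      fix x assume x: "x \<in> space M"
      show "m N x - m N (T x) \<le> indicator B x * indicator (E N) x - \<alpha> * indicator (E N) x"
      proof (cases "m N x > 0")
        case True
        \<comment> \<open>Where m N is positive, so is m (N + 1), and the maximum with 0 in its recursion is redundant.\<close>
        then have "m N x \<le> f x + m N (T x)" using mono[of N x] unfolding mS by simp
        then show ?thesis using True x unfolding f_def E_def by simp
      next
        case False
        then show ?thesis using nonneg[of N "T x"] unfolding E_def by simp
      qed
    qed (use int_m int_mT int_f in auto)
    also have "\<dots> = (\<integral>x. indicator (B \<inter> E N) x - \<alpha> * indicator (E N) x \<partial>M)"
      by (simp add: indicator_inter_arith)
    also have "\<dots> = measure M (B \<inter> E N) - \<alpha> * measure M (E N)"
      by (subst Bochner_Integration.integral_diff) (auto simp: emeasure_eq_measure)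
    finally have "\<alpha> * measure M (E N) \<le> measure M (B \<inter> E N)" by simp
    also have "\<dots> \<le> measure M B" by (rule finite_measure_mono) auto
    finally show ?thesis .
  qed
  have "incseq E" unfolding E_def
    by (rule incseq_SucI) (use mono less_le_trans in blast)
  then have "(\<lambda>N. measure M (E N)) \<longlonglongrightarrow> measure M (\<Union>N. E N)"
    by (intro finite_Lim_measure_incseq) auto
  then have "(\<lambda>N. \<alpha> * measure M (E N)) \<longlonglongrightarrow> \<alpha> * measure M (\<Union>N. E N)"
    by (intro tendsto_intros)
  then have "\<alpha> * measure M (\<Union>N. E N) \<le> measure M B"
    by (rule LIMSEQ_le_const2) (use le in auto)
  moreover have "{x \<in> space M. \<exists>n. (\<Sum>i<n. indicator B ((T ^^ i) x) - \<alpha>) > 0} \<subseteq> (\<Union>N. E N)"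
    using S_le unfolding E_def f_def by (auto intro: less_le_trans)
  ultimately show ?thesis by (intro bexI[of _ "\<Union>N. E N"]) auto
qed

text \<open>Think of \<open>G k\<close> as the set where some function \<open>h\<close> is at most \<open>k\<close>, so that
\<open>h \<circ> T \<ge> h - 1\<close> by the hypothesis \<open>pull\<close>. The claim is that \<open>h\<close>
grows sublinearly along almost every orbit on which it is finite.

The reason is that \<open>h\<close> can only decrease slowly. If \<open>h\<close> exceeds \<open>n / m\<close> at time
\<open>n\<close>, it stays above a fixed level \<open>N\<close> for a further stretch of about \<open>n / m\<close>
steps. An orbit on which this happens for arbitrarily large \<open>n\<close> thus spends, up to
suitable times, a fraction of its time of order \<open>1 / m\<close> in \<open>{N < h < \<infinity>}\<close>. By the
maximal inequality such orbits start in a set of measure at most of order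
\<open>m * measure M {N < h < \<infinity>}\<close>, and this tends to 0 as \<open>N\<close> grows.\<close>

lemma AE_tempered:
  fixes M :: "'a measure" and T :: "'a \<Rightarrow> 'a" and G :: "nat \<Rightarrow> 'a set"
  assumes M: "prob_space M" and T: "T \<in> measurable M M" and inv: "distr M M T = M"
    and G: "\<And>k. G k \<in> sets M" "incseq G"
    and pull: "\<And>x k. x \<in> space M \<Longrightarrow> T x \<in> G k \<Longrightarrow> x \<in> G (Suc k)"
    and push: "\<And>x. x \<in> (\<Union>k. G k) \<Longrightarrow> T x \<in> (\<Union>k. G k)"
  shows "AE x in M. x \<in> (\<Union>k. G k) \<longrightarrow>
    (\<forall>m\<ge>1. \<forall>\<^sub>F n in sequentially. (T ^^ n) x \<in> G (n div m))"
proof -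
  interpret prob_space M by fact
  have "AE x in M. x \<in> (\<Union>k. G k) \<longrightarrow> (\<forall>\<^sub>F n in sequentially. (T ^^ n) x \<in> G (n div m))"
    if m: "m \<ge> 1" for m
  proof -
    \<comment> \<open>A visiting frequency that is certainly exceeded: below, at least n / (2 m) of at most 3 n times are visits.\<close>
    define \<alpha> where "\<alpha> = 1 / (8 * real m)"
    have \<alpha>: "\<alpha> > 0" unfolding \<alpha>_def using m by simp
    define B where "B = (\<lambda>N. (\<Union>k. G k) - G N)"
    have B: "B N \<in> sets M" for N unfolding B_def using G(1) by blast
    have "\<exists>E\<in>sets M. \<alpha> * measure M E \<le> measure M (B N) \<and>
      {x \<in> space M. \<exists>n. (\<Sum>i<n. indicator (B N) ((T ^^ i) x) - \<alpha>) > 0} \<subseteq> E" for N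
      using maximal_ergodic_inequality[OF M T inv B \<alpha>] .
    then have "\<forall>N. \<exists>E. E \<in> sets M \<and> \<alpha> * measure M E \<le> measure M (B N) \<and>
      {x \<in> space M. \<exists>n. (\<Sum>i<n. indicator (B N) ((T ^^ i) x) - \<alpha>) > 0} \<subseteq> E"
      by blast
    then obtain E where "\<forall>N. E N \<in> sets M \<and> \<alpha> * measure M (E N) \<le> measure M (B N) \<and>
      {x \<in> space M. \<exists>n. (\<Sum>i<n. indicator (B N) ((T ^^ i) x) - \<alpha>) > 0} \<subseteq> E N"
      by (rule choice[THEN exE])
    then have E: "\<And>N. E N \<in> sets M" "\<And>N. \<alpha> * measure M (E N) \<le> measure M (B N)"
      "\<And>N. {x \<in> space M. \<exists>n. (\<Sum>i<n. indicator (B N) ((T ^^ i) x) - \<alpha>) > 0} \<subseteq> E N"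
      by blast+
    have "(\<lambda>N. measure M (B N)) \<longlonglongrightarrow> measure M (\<Inter>N. B N)"
      using B G(2) by (intro finite_Lim_measure_decseq) (auto simp: B_def decseq_def incseq_def)
    moreover have "(\<Inter>N. B N) = {}" unfolding B_def by blast
    ultimately have lim: "(\<lambda>N. measure M (B N)) \<longlonglongrightarrow> 0" by simp
    have "\<alpha> * measure M (\<Inter>N. E N) \<le> measure M (B N)" for N
    proof -
      have "measure M (\<Inter>N. E N) \<le> measure M (E N)"
        using E(1) by (intro finite_measure_mono) auto
      then show ?thesis using E(2)[of N] \<alpha> by (meson mult_left_mono less_imp_le order_trans)
    qed
    then have "\<alpha> * measure M (\<Inter>N. E N) \<le> 0"
      by (intro LIMSEQ_le_const[OF lim]) auto
    then have "measure M (\<Inter>N. E N) = 0"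
      using \<alpha> by (simp add: mult_le_0_iff measure_le_0_iff)
    moreover have "(\<Inter>N. E N) \<in> sets M" using E(1) by auto
    ultimately have null: "(\<Inter>N. E N) \<in> null_sets M"
      by (simp add: null_setsI emeasure_eq_measure)
    have key: "x \<in> E N" if x: "x \<in> space M" "x \<in> (\<Union>k. G k)"
      and freq: "\<not> (\<forall>\<^sub>F n in sequentially. (T ^^ n) x \<in> G (n div m))" for x N
    proof -
      have orbit: "(T ^^ i) x \<in> space M" for i
        using x(1) measurable_space[OF T] by (induction i) auto
      have inG: "(T ^^ i) x \<in> (\<Union>k. G k)" for i
        using x(2) push by (induction i) auto
      \<comment> \<open>The time n is so late that N is at most half of n div m.\<close>
      obtain n where n: "n \<ge> 2 * m * N + 1" "(T ^^ n) x \<notin> G (n div m)"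
        using freq unfolding eventually_sequentially by blast
      define J where "J = n div m"
      have "2 * N \<le> J"
        unfolding J_def using n(1) m
        by (simp add: less_eq_div_iff_mult_less_eq mult.commute mult.left_commute)
      then have JN: "N \<le> J" by simp
      have "J \<le> n" unfolding J_def by simp
      have "n = m * J + n mod m" unfolding J_def by simp
      moreover have "n mod m < m" using m by simp
      ultimately have "n \<le> m * (J + 1)" by simp
      then have Jn: "real n \<le> real m * (real J + 1)"
        by (metis of_nat_1 of_nat_add of_nat_le_iff of_nat_mult)
      have out: "(T ^^ (n + j)) x \<notin> G (J - j)" if "j \<le> J" for j
        using that
      proof (induction j)
        case 0
        then show ?case using n(2) J_def by simp
      next
        case (Suc j)
        then have "(T ^^ (n + j)) x \<notin> G (Suc (J - Suc j))" by (simp add: Suc_diff_Suc)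
        then show ?case using pull[OF orbit[of "n + j"], of "J - Suc j"] by auto
      qed
      define p where "p = n + (J - N) + 1"
      have inB: "(T ^^ i) x \<in> B N" if "i \<in> {n..<p}" for i
      proof -
        define j where "j = i - n"
        have j: "j \<le> J - N" "i = n + j" using that unfolding p_def j_def by auto
        then have "N \<le> J - j" "j \<le> J" using JN by auto
        then have "(T ^^ i) x \<notin> G N" using out[of j] j(2) incseqD[OF G(2)] by blast
        then show ?thesis unfolding B_def using inG by blast
      qed
      have "real (J - N + 1) = (\<Sum>i\<in>{n..<p}. indicator (B N) ((T ^^ i) x))"
        using inB by (simp add: p_def)
      also have "\<dots> \<le> (\<Sum>i<p. indicator (B N) ((T ^^ i) x) :: real)"
        by (rule sum_mono2) auto
      finally have ge: "real J - real N + 1 \<le> (\<Sum>i<p. indicator (B N) ((T ^^ i) x) :: real)"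
        using JN by (simp add: of_nat_diff)
      have "real n \<ge> 2 * real m * real N + 1"
        using n(1) by (metis of_nat_1 of_nat_add of_nat_le_iff of_nat_mult of_nat_numeral)
      moreover have "real p \<le> 2 * real n + 1"
        unfolding p_def using \<open>J \<le> n\<close> by simp
      ultimately have "real p < 8 * real m * (real J - real N + 1)"
        using Jn m by (simp add: algebra_simps)
      then have "\<alpha> * real p < real J - real N + 1"
        unfolding \<alpha>_def using m by (simp add: field_simps)
      then have "(\<Sum>i<p. indicator (B N) ((T ^^ i) x) - \<alpha>) > 0"
        using ge by (simp add: sum_subtractf mult.commute)
      then show ?thesis using E(3)[of N] x(1) by blast
    qed
    show ?thesis
      by (rule AE_I'[OF null]) (use key in blast)
  qed
  then have "AE x in M. \<forall>m\<in>{1..}. x \<in> (\<Union>k. G k) \<longrightarrow>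
      (\<forall>\<^sub>F n in sequentially. (T ^^ n) x \<in> G (n div m))"
    by (intro AE_ball_countable'[OF _ countableI_type]) auto
  then show ?thesis by eventually_elim auto
qed

section \<open>Growth along an orbit\<close>

lemma C1_diffeo_image:
  assumes "C1_diffeo X f"
  shows "f ` X = X"
  using assms unfolding C1_diffeo_def bij_betw_def by blast

lemma C1_diffeo_funpow_strict_derivative:
  assumes "C1_diffeo X f" "x \<in> X"
  shows "\<exists>D. strict_derivative X (f ^^ n) D x"
proof (induction n)
  case 0
  have "lipschitz_near X (\<lambda>y. y - y) x e" if "e > 0" for e
    unfolding lipschitz_near_def using that by (intro exI[of _ UNIV]) (simp add: lipschitz_on_def)
  then have "strict_derivative X (f ^^ 0) (\<lambda>v. v) x"
    unfolding strict_derivative_def by (auto simp: id_def)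
  then show ?case by blast
next
  case (Suc n)
  then obtain D where D: "strict_derivative X (f ^^ n) D x" by blast
  have maps: "(f ^^ n) ` X \<subseteq> X"
    using funpow_differentiable[OF assms(1)] by blast
  then have "(f ^^ n) x \<in> X" using assms(2) by blast
  then obtain E where E: "strict_derivative X f E ((f ^^ n) x)"
    using C1_map_strict_derivative assms(1) unfolding C1_diffeo_def by metis
  have "strict_derivative X (\<lambda>y. f ((f ^^ n) y)) (\<lambda>v. E (D v)) x"
    by (rule strict_derivative_compose[OF D E assms(2) maps])
  then show ?case by (auto simp: o_def)
qed

lemma linear_tangent_map_funpow:
  assumes "C1_diffeo X f" "x \<in> X"
  shows "linear (tangent_map X (f ^^ n) x)"
  using linear_frechet_derivative funpow_differentiable[OF assms]
  unfolding tangent_map_def by blast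

lemma tangent_map_funpow_Suc:
  assumes f: "C1_diffeo X f" "y \<in> X" and v: "v \<in> tangent_space X y"
  shows "tangent_map X f ((f ^^ n) y) (tangent_map X (f ^^ n) y v) = tangent_map X (f ^^ Suc n) y v"
proof -
  have maps: "(f ^^ n) ` X \<subseteq> X" using funpow_differentiable[OF f(1)] by blast
  have "((f ^^ n) has_derivative tangent_map X (f ^^ n) y) (at y within X)"
    using funpow_differentiable[OF f] unfolding tangent_map_def frechet_derivative_works by blast
  moreover have "(f has_derivative tangent_map X f ((f ^^ n) y)) (at ((f ^^ n) y) within (f ^^ n) ` X)"
  proof (rule has_derivative_subset[OF _ maps])
    have "f differentiable (at ((f ^^ n) y) within X)"
      using f maps C1_map_differentiable unfolding C1_diffeo_def by blast
    then show "(f has_derivative tangent_map X f ((f ^^ n) y)) (at ((f ^^ n) y) within X)"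
      unfolding tangent_map_def frechet_derivative_works .
  qed
  ultimately have "((f \<circ> f ^^ n) has_derivative
      (tangent_map X f ((f ^^ n) y) \<circ> tangent_map X (f ^^ n) y)) (at y within X)"
    by (rule diff_chain_within)
  from tangent_map_eq[OF this v] show ?thesis by simp
qed

text \<open>Variation of constants: unrolling the recursion propagates each inhomogeneity
\<open>C s\<close> from time \<open>s\<close> to time \<open>t\<close>.\<close>

lemma cocycle_sum_eq:
  assumes f: "C1_diffeo X f" "x \<in> X"
    and C: "\<And>s. s \<ge> 1 \<Longrightarrow> C s \<in> tangent_space X ((f ^^ s) x)"
  shows "cocycle_sum X f x C t = (\<Sum>s=1..t. tangent_map X (f ^^ (t - s)) ((f ^^ s) x) (C s))"
proof (induction t)
  case (Suc t)
  have inX: "(f ^^ s) x \<in> X" for s using funpow_differentiable[OF f] by blast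
  have "linear (tangent_map X f ((f ^^ t) x))"
    using linear_tangent_map_funpow[OF f(1) inX, of 1] by simp
  then have "tangent_map X f ((f ^^ t) x) (cocycle_sum X f x C t) =
      (\<Sum>s=1..t. tangent_map X f ((f ^^ t) x) (tangent_map X (f ^^ (t - s)) ((f ^^ s) x) (C s)))"
    unfolding Suc by (rule linear_sum)
  also have "\<dots> = (\<Sum>s=1..t. tangent_map X (f ^^ (Suc t - s)) ((f ^^ s) x) (C s))"
  proof (rule sum.cong[OF refl])
    fix s assume s: "s \<in> {1..t}"
    then have "(f ^^ t) x = (f ^^ (t - s)) ((f ^^ s) x)" "Suc t - s = Suc (t - s)"
      by (auto simp: funpow_add[symmetric, THEN fun_cong, unfolded o_def] Suc_diff_le)
    then show "tangent_map X f ((f ^^ t) x) (tangent_map X (f ^^ (t - s)) ((f ^^ s) x) (C s)) =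
        tangent_map X (f ^^ (Suc t - s)) ((f ^^ s) x) (C s)"
      using tangent_map_funpow_Suc[OF f(1) inX C, where n="t - s"] s by simp
  qed
  finally have 1: "tangent_map X f ((f ^^ t) x) (cocycle_sum X f x C t) = \<dots>" .
  have "tangent_map X (f ^^ 0) ((f ^^ Suc t) x) (C (Suc t)) = C (Suc t)"
    by (rule tangent_map_eq) (use C[of "Suc t"] in \<open>auto simp: id_def\<close>)
  then show ?case using 1 by simp
qed simp

lemma norm_cocycle_sum_le:
  assumes f: "C1_diffeo X f" "x \<in> X"
    and C: "\<And>s. s \<ge> 1 \<Longrightarrow> C s \<in> tangent_space X ((f ^^ s) x) \<and> norm (C s) \<le> K"
    and b: "0 \<le> r" "\<And>n s v. v \<in> tangent_space X ((f ^^ s) x) \<Longrightarrow>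
      norm (tangent_map X (f ^^ n) ((f ^^ s) x) v) \<le> r * exp (\<beta> * real (n + s)) * norm v"
  shows "norm (cocycle_sum X f x C t) \<le> real t * (r * exp (\<beta> * real t) * K)"
proof -
  have "norm (cocycle_sum X f x C t) \<le>
      (\<Sum>s=1..t. norm (tangent_map X (f ^^ (t - s)) ((f ^^ s) x) (C s)))"
    using C by (subst cocycle_sum_eq[OF f]) (auto intro: norm_sum)
  also have "\<dots> \<le> (\<Sum>s=1..t. r * exp (\<beta> * real t) * K)"
  proof (rule sum_mono)
    fix s assume s: "s \<in> {1..t}"
    then have "norm (tangent_map X (f ^^ (t - s)) ((f ^^ s) x) (C s)) \<le>
        r * exp (\<beta> * real t) * norm (C s)"
      using b(2)[of "C s" s "t - s"] C[of s] by simp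
    also have "\<dots> \<le> r * exp (\<beta> * real t) * K"
      using C[of s] s b(1) by (intro mult_left_mono) auto
    finally show "norm (tangent_map X (f ^^ (t - s)) ((f ^^ s) x) (C s)) \<le> r * exp (\<beta> * real t) * K" .
  qed
  also have "\<dots> = real t * (r * exp (\<beta> * real t) * K)" by simp
  finally show ?thesis .
qed

lemma lyapunov_exponent_le_of_bound:
  assumes "\<And>n. norm (tangent_map X (f ^^ n) x v) \<le> c * exp (a * real n)"
  shows "lyapunov_exponent X f x v \<le> ereal a"
  unfolding lyapunov_exponent_def growth_le_iff
proof (intro allI impI)
  fix r assume "ereal a < ereal r"
  then have "\<forall>\<^sub>F t in sequentially. c * exp (a * real t) < exp (r * real t)"
    by (intro exp_eventually_dominates) simp
  then show "\<forall>\<^sub>F t in sequentially. norm (tangent_map X (f ^^ t) x v) < exp (r * real t)"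
    by eventually_elim (use assms le_less_trans in blast)
qed

lemma lyapunov_exponent_less_bound:
  assumes "lyapunov_exponent X f x v < ereal c" "c \<ge> 0"
  shows "\<exists>r\<ge>0. \<forall>n. norm (tangent_map X (f ^^ n) x v) \<le> r * exp (c * real n)"
proof -
  let ?A = "\<lambda>n. tangent_map X (f ^^ n) x v"
  have "\<forall>\<^sub>F n in sequentially. norm (?A n) < exp (c * real n)"
    using growth_le_iff[of ?A "lyapunov_exponent X f x v"] assms(1)
    unfolding lyapunov_exponent_def by simp
  then obtain N where N: "\<And>n. n \<ge> N \<Longrightarrow> norm (?A n) < exp (c * real n)"
    unfolding eventually_sequentially by blast
  define r where "r = 1 + (\<Sum>n<N. norm (?A n))"
  have r: "r \<ge> 1" unfolding r_def by (simp add: sum_nonneg)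
  have "norm (?A n) \<le> r * exp (c * real n)" for n
  proof (cases "n < N")
    case True
    then have "norm (?A n) \<le> (\<Sum>n<N. norm (?A n))"
      by (intro member_le_sum) auto
    then have "norm (?A n) \<le> r" unfolding r_def by simp
    also have "r * 1 \<le> r * exp (c * real n)"
      using r assms(2) by (intro mult_left_mono) auto
    finally show ?thesis by simp
  next
    case False
    then have "norm (?A n) \<le> 1 * exp (c * real n)" using N[of n] by simp
    also have "\<dots> \<le> r * exp (c * real n)" using r by (intro mult_right_mono) auto
    finally show ?thesis .
  qed
  then show ?thesis using r by (intro exI[of _ r]) auto
qed

text \<open>A Lyapunov exponent controls one vector at a time. Applying this to the images of an
orthonormal basis of the parameter space \<open>S\<close> of a chart gives a bound that is uniform in the
direction, and \<open>lipschitz_near_of_tangent_bound\<close> turns it into local Lipschitz constants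
of all iterates at \<open>x\<close>.\<close>

lemma lipschitz_near_funpow_of_lyapunov:
  assumes X: "C1_submanifold q X" and f: "C1_diffeo X f" "x \<in> X"
    and c: "largest_lyapunov X f x < ereal c" "c \<ge> 0"
  shows "\<exists>r. \<forall>n. lipschitz_near X (f ^^ n) x (r * exp (c * real n))" (is ?goal)
proof (rule lipschitz_near_of_tangent_bound[OF X f(2)])
  fix S :: "'a set" and P :: "'a \<Rightarrow> 'a" and d :: real
  assume S: "subspace S" "linear P" "\<And>s. s \<in> S \<Longrightarrow> P s \<in> tangent_space X x" "d > 0"
    and lip: "\<And>(g :: 'a \<Rightarrow> 'a) D B. strict_derivative X g D x \<Longrightarrow> B > 0 \<Longrightarrow>
      (\<And>s. s \<in> S \<Longrightarrow> norm (D (P s)) \<le> B * norm s) \<Longrightarrow> lipschitz_near X g x (d * B)"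
  obtain B where B: "B \<subseteq> S" "pairwise orthogonal B" "\<And>b. b \<in> B \<Longrightarrow> norm b = 1"
      "independent B" "span B = S"
    using orthonormal_basis_subspace[OF S(1)] by metis
  have fin: "finite B" using B(4) independent_imp_finite by blast
  let ?A = "\<lambda>n. tangent_map X (f ^^ n) x"
  have lin: "linear (?A n)" for n using linear_tangent_map_funpow[OF f] .
  have "\<exists>r\<ge>0. \<forall>n. norm (?A n (P b)) \<le> r * exp (c * real n)" if "b \<in> B" for b
  proof (cases "P b = 0")
    case True
    then show ?thesis using lin linear_0 by (intro exI[of _ 0]) auto
  next
    case False
    then have "lyapunov_exponent X f x (P b) \<le> largest_lyapunov X f x"
      unfolding largest_lyapunov_def using that B(1) S(3) by (intro Sup_upper) auto
    then show ?thesis using lyapunov_exponent_less_bound c by (metis le_less_trans)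
  qed
  then have "\<forall>b\<in>B. \<exists>r. r \<ge> 0 \<and> (\<forall>n. norm (?A n (P b)) \<le> r * exp (c * real n))"
    by blast
  from bchoice[OF this] obtain r
    where r: "\<And>b. b \<in> B \<Longrightarrow> r b \<ge> 0" "\<And>b n. b \<in> B \<Longrightarrow> norm (?A n (P b)) \<le> r b * exp (c * real n)"
    by blast
  define R where "R = 1 + sum r B"
  have R: "R > 0" unfolding R_def using r(1) by (simp add: add_pos_nonneg sum_nonneg)
  have "lipschitz_near X (f ^^ n) x (d * (R * exp (c * real n)))" for n
  proof -
    obtain D where D: "strict_derivative X (f ^^ n) D x"
      using C1_diffeo_funpow_strict_derivative[OF f] by blast
    from D show ?thesis
    proof (rule lip)
      show "R * exp (c * real n) > 0" using R by simp
      fix s assume s: "s \<in> S"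
      have "D (P s) = ?A n (P s)"
        using tangent_map_eq[OF strict_derivative_has_derivative[OF D f(2)] S(3)[OF s]] by simp
      also have "\<dots> = ?A n (\<Sum>b\<in>B. (s \<bullet> b) *\<^sub>R P b)"
        using orthonormal_basis_expand[OF B(2,3) _ fin, of s] s B(5)
        by (metis (no_types, lifting) S(2) linear_scale linear_sum sum.cong)
      also have "\<dots> = (\<Sum>b\<in>B. (s \<bullet> b) *\<^sub>R ?A n (P b))"
        using lin[of n] by (simp add: linear_sum linear_scale)
      finally have "norm (D (P s)) \<le> (\<Sum>b\<in>B. norm ((s \<bullet> b) *\<^sub>R ?A n (P b)))"
        by (simp only: norm_sum)
      also have "\<dots> \<le> (\<Sum>b\<in>B. norm s * (r b * exp (c * real n)))"
      proof (rule sum_mono)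
        fix b assume b: "b \<in> B"
        have "\<bar>s \<bullet> b\<bar> \<le> norm s" using Cauchy_Schwarz_ineq2[of s b] B(3)[OF b] by simp
        then show "norm ((s \<bullet> b) *\<^sub>R ?A n (P b)) \<le> norm s * (r b * exp (c * real n))"
          using r(2)[OF b, of n] by (simp add: mult_mono)
      qed
      also have "\<dots> = (sum r B * exp (c * real n)) * norm s"
        by (simp add: sum_distrib_left sum_distrib_right mult.commute)
      also have "\<dots> \<le> (R * exp (c * real n)) * norm s"
        unfolding R_def by (intro mult_right_mono) auto
      finally show "norm (D (P s)) \<le> (R * exp (c * real n)) * norm s" .
    qed
  qed
  then show ?goal by (intro exI[of _ "d * R"]) (simp add: mult.assoc)
qed

section \<open>Level sets of the growth constant\<close>

text \<open>The level \<open>k\<close> is the logarithm to base \<open>M\<close> of the constant in front of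
\<open>exp (c * n)\<close>. On this scale one application of a map with Lipschitz constant
\<open>M\<close> shifts the level by one, which is the form in which \<open>AE_tempered\<close> can be used.\<close>

definition growth_level ::
    "'a::euclidean_space set \<Rightarrow> ('a \<Rightarrow> 'a) \<Rightarrow> real \<Rightarrow> real \<Rightarrow> nat \<Rightarrow> 'a set" where
  "growth_level X f M c k = {x. \<forall>n. lipschitz_near X (f ^^ n) x (M ^ k * exp (c * real n))}"

lemma growth_level_borel: "growth_level X f M c k \<in> sets borel"
proof -
  have "growth_level X f M c k = (\<Inter>n. {x. lipschitz_near X (f ^^ n) x (M ^ k * exp (c * real n))})"
    unfolding growth_level_def by auto
  also have "\<dots> \<in> sets borel"
    by (intro sets.countable_INT'' borel_open open_lipschitz_near) auto
  finally show ?thesis .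
qed

lemma incseq_growth_level:
  assumes "M \<ge> 1"
  shows "incseq (growth_level X f M c)"
proof (rule incseq_SucI, rule subsetI)
  fix k x assume x: "x \<in> growth_level X f M c k"
  have "M ^ k * exp (c * real n) \<le> M ^ Suc k * exp (c * real n)" for n
    using assms by (intro mult_right_mono power_increasing) auto
  with x show "x \<in> growth_level X f M c (Suc k)"
    unfolding growth_level_def using lipschitz_near_mono[OF _ _ order_refl] by blast
qed

text \<open>Since \<open>f ^^ Suc m = f ^^ m \<circ> f\<close>, passing from \<open>f x\<close> back to \<open>x\<close> costs a
single factor \<open>M\<close>.\<close>

lemma growth_level_pullback:
  assumes f: "f ` X \<subseteq> X" "x \<in> X" and M: "M \<ge> 1" "lipschitz_near X f x M" and c: "c \<ge> 0"
    and fx: "f x \<in> growth_level X f M c k"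
  shows "x \<in> growth_level X f M c (Suc k)"
  unfolding growth_level_def
proof (intro CollectI allI)
  fix n
  show "lipschitz_near X (f ^^ n) x (M ^ Suc k * exp (c * real n))"
  proof (cases n)
    case 0
    have "lipschitz_near X (f ^^ 0) x 1"
      unfolding lipschitz_near_def by (intro exI[of _ UNIV]) (simp add: lipschitz_on_def)
    then show ?thesis
      unfolding 0 by (rule lipschitz_near_mono) (use one_le_power[OF M(1), of "Suc k"] in auto)
  next
    case (Suc m)
    have "lipschitz_near X (f ^^ m) (f x) (M ^ k * exp (c * real m))"
      using fx unfolding growth_level_def by blast
    from lipschitz_near_compose[OF M(2) this f(2) open_UNIV]
    have "lipschitz_near X (f ^^ n) x (M ^ k * exp (c * real m) * M)"
      unfolding Suc funpow_Suc_right o_def using f(1) by auto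
    moreover have "M ^ k * exp (c * real m) * M \<le> M ^ Suc k * exp (c * real n)"
      unfolding Suc using M(1) c by (simp add: mult_mono)
    ultimately show ?thesis by (elim lipschitz_near_mono) auto
  qed
qed

text \<open>Here \<open>f ^^ n\<close> near \<open>f x\<close> is \<open>f ^^ Suc n\<close> composed with the inverse of \<open>f\<close>. The
inverse has some local Lipschitz constant at \<open>f x\<close>, of unspecified size, so the level may jump by
an uncontrolled amount, but it remains finite.\<close>

lemma growth_level_pushforward:
  assumes f: "C1_diffeo X f" "x \<in> X" and M: "M > 1"
    and x: "x \<in> (\<Union>k. growth_level X f M c k)"
  shows "f x \<in> (\<Union>k. growth_level X f M c k)"
proof -
  obtain k where k: "\<And>n. lipschitz_near X (f ^^ n) x (M ^ k * exp (c * real n))"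
    using x unfolding growth_level_def by blast
  let ?g = "inv_into X f"
  have img: "f ` X = X" and inj: "inj_on f X"
    using f(1) unfolding C1_diffeo_def bij_betw_def by auto
  have gf: "?g (f x) = x" using inj f(2) by simp
  have fg: "f (?g y) = y" if "y \<in> X" for y using that img by (simp add: f_inv_into_f)
  have gX: "?g ` X \<subseteq> X" using img inv_into_into[of _ f X] by auto
  have fx: "f x \<in> X" using img f(2) by blast
  obtain D where "strict_derivative X ?g D (f x)"
    using C1_map_strict_derivative fx f(1) unfolding C1_diffeo_def by blast
  then obtain d where d: "lipschitz_near X ?g (f x) d"
    using strict_derivative_lipschitz_near[of X ?g D "f x" 1] by auto
  obtain j where j: "exp c * d < M ^ j" using real_arch_pow[OF M] by blast
  have "lipschitz_near X (f ^^ n) (f x) (M ^ (k + j) * exp (c * real n))" for n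
  proof -
    have "lipschitz_near X (f ^^ Suc n) (?g (f x)) (M ^ k * exp (c * real (Suc n)))"
      using k[of "Suc n"] by (simp only: gf)
    from lipschitz_near_compose[OF d this fx open_UNIV UNIV_I]
    have "lipschitz_near X (\<lambda>y. (f ^^ Suc n) (?g y)) (f x) (M ^ k * exp (c * real (Suc n)) * d)"
      using gX by blast
    then have "lipschitz_near X (f ^^ n) (f x) (M ^ k * exp (c * real (Suc n)) * d)"
      by (rule lipschitz_near_transform[OF _ open_UNIV UNIV_I])
        (use fg in \<open>auto simp: funpow_swap1\<close>)
    moreover have "M ^ k * exp (c * real (Suc n)) * d \<le> M ^ (k + j) * exp (c * real n)"
    proof -
      have "M ^ k * exp (c * real (Suc n)) * d = M ^ k * exp (c * real n) * (exp c * d)"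
        by (simp add: exp_add algebra_simps)
      also have "\<dots> \<le> M ^ k * exp (c * real n) * M ^ j"
        using j M by (intro mult_left_mono) auto
      finally show ?thesis by (simp add: power_add algebra_simps)
    qed
    ultimately show ?thesis by (elim lipschitz_near_mono) auto
  qed
  then show ?thesis unfolding growth_level_def by blast
qed

lemma growth_level_of_lyapunov:
  assumes "C1_submanifold q X" and "C1_diffeo X f" "x \<in> X"
    and "largest_lyapunov X f x < ereal c" "c \<ge> 0" and M: "M > 1"
  shows "x \<in> (\<Union>k. growth_level X f M c k)"
proof -
  obtain r where r: "\<And>n. lipschitz_near X (f ^^ n) x (r * exp (c * real n))"
    using lipschitz_near_funpow_of_lyapunov[OF assms(1-5)] by blast
  obtain k where "r < M ^ k" using real_arch_pow[OF M] by blast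
  then have "r * exp (c * real n) \<le> M ^ k * exp (c * real n)" for n by simp
  then show ?thesis
    unfolding growth_level_def using r lipschitz_near_mono[OF _ _ order_refl] by blast
qed

lemma uniform_lipschitz_near_compact:
  assumes "C1_map X f" "X' \<subseteq> X" "compact X'"
  shows "\<exists>M>1. \<forall>x\<in>X'. lipschitz_near X f x M"
proof -
  let ?U = "\<lambda>n::nat. {x. lipschitz_near X f x (real n)}"
  have "X' \<subseteq> (\<Union>n. ?U n)"
  proof
    fix x assume "x \<in> X'"
    then obtain D where "strict_derivative X f D x"
      using C1_map_strict_derivative assms(1,2) by blast
    then obtain d where d: "lipschitz_near X f x d"
      using strict_derivative_lipschitz_near[of X f D x 1] by auto
    obtain n where "d \<le> real n" using real_arch_simple by blast
    with d have "lipschitz_near X f x (real n)" by (rule lipschitz_near_mono) simp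
    then show "x \<in> (\<Union>n. ?U n)" by blast
  qed
  then obtain F where F: "finite F" "X' \<subseteq> (\<Union>n\<in>F. ?U n)"
    by (rule compactE_image[OF assms(3) open_lipschitz_near])
  define M where "M = 2 + real (\<Sum>F)"
  have "lipschitz_near X f x M" if "x \<in> X'" for x
  proof -
    obtain n where n: "n \<in> F" "lipschitz_near X f x (real n)" using F(2) \<open>x \<in> X'\<close> by blast
    have "n \<le> \<Sum>F" using member_le_sum[of n F "\<lambda>n. n"] n(1) F(1) by simp
    then have "real n \<le> M" unfolding M_def by linarith
    with n(2) show ?thesis by (rule lipschitz_near_mono) simp
  qed
  moreover have "M > 1" unfolding M_def using of_nat_0_le_iff[of "\<Sum>F"] by linarith
  ultimately show ?thesis by blast
qed

text \<open>Finiteness from above matters because \<open>real_of_ereal\<close> sends \<open>\<infinity>\<close> to 0.\<close>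

lemma largest_lyapunov_le:
  assumes f: "C1_diffeo X f" "x \<in> X" and M: "M > 1"
    and orbit: "\<And>n. lipschitz_near X f ((f ^^ n) x) M"
  shows "largest_lyapunov X f x \<le> ereal (ln M)"
proof -
  have maps: "f ` X \<subseteq> X" using C1_diffeo_image[OF f(1)] by simp
  have "lipschitz_near X (f ^^ n) x (M ^ n)" for n
  proof (induction n)
    case 0
    show ?case unfolding lipschitz_near_def by (intro exI[of _ UNIV]) (simp add: lipschitz_on_def)
  next
    case (Suc n)
    have "(f ^^ n) ` (X \<inter> UNIV) \<subseteq> X" using funpow_differentiable[OF f(1)] by blast
    from lipschitz_near_compose[OF Suc orbit f(2) open_UNIV UNIV_I this] show ?case
      by (simp add: o_def)
  qed
  then have "norm (tangent_map X (f ^^ n) x v) \<le> M ^ n * norm v" if "v \<in> tangent_space X x" for n v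
    using lipschitz_near_tangent_map_le funpow_differentiable[OF f] that by blast
  moreover have "M ^ n = exp (ln M * real n)" for n
    using M by (simp add: exp_of_nat2_mult)
  ultimately have "lyapunov_exponent X f x v \<le> ereal (ln M)" if "v \<in> tangent_space X x" for v
    using that by (intro lyapunov_exponent_le_of_bound[where c="norm v"]) (auto simp: mult.commute)
  then show ?thesis unfolding largest_lyapunov_def by (intro Sup_least) auto
qed

section \<open>Conclusion\<close>

text \<open>The propagator from time \<open>s\<close> to time \<open>n + s\<close> is bounded by \<open>exp (c * n)\<close> times the
growth constant at the point \<open>(f ^^ s) x\<close>. Temperedness bounds this constant by a fixed power of
\<open>M\<close> times \<open>exp (\<delta> / 2 * s)\<close>, so every propagator that ends at time \<open>t\<close> is of order
\<open>exp (t * (L + \<delta> / 2))\<close>. The number \<open>t\<close> of summands is absorbed in another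
\<open>exp (\<delta> / 2 * t)\<close>.\<close>

lemma cocycle_sum_bound_of_tempered:
  assumes f: "C1_diffeo X f" "x \<in> X" and M: "M > 1" and \<delta>: "\<delta> > 0" and L: "L \<ge> 0"
    and c: "c \<le> L + \<delta> / 2"
    and x: "x \<in> (\<Union>k. growth_level X f M c k)"
    and tempered: "\<And>m. m \<ge> 1 \<Longrightarrow> \<forall>\<^sub>F n in sequentially. (f ^^ n) x \<in> growth_level X f M c (n div m)"
  shows "\<exists>R. \<forall>K C. K > 0 \<longrightarrow>
    (\<forall>t\<ge>1. C t \<in> tangent_space X ((f ^^ t) x) \<and> norm (C t) \<le> K) \<longrightarrow>
    (\<forall>t. norm (cocycle_sum X f x C t) \<le> R * K * exp (real t * (L + \<delta>)))"
proof -
  let ?G = "growth_level X f M c"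
  have inX: "(f ^^ n) x \<in> X" for n using funpow_differentiable[OF f] by blast
  \<comment> \<open>The rate 1 / m at which the level may grow is so small that M^(s div m) is at most exp (\<delta> / 2 * s).\<close>
  obtain m0 :: nat where m0: "ln M / (\<delta> / 2) \<le> real m0" using real_arch_simple by blast
  define m where "m = max 1 m0"
  have m: "m \<ge> 1" "ln M / real m \<le> \<delta> / 2"
  proof -
    show "m \<ge> 1" unfolding m_def by simp
    have "real m0 \<le> real m" unfolding m_def by simp
    then have "ln M / (\<delta> / 2) \<le> real m" using m0 by linarith
    then show "ln M / real m \<le> \<delta> / 2" using \<delta> \<open>m \<ge> 1\<close> by (simp add: field_simps)
  qed
  obtain N where N: "\<And>n. n \<ge> N \<Longrightarrow> (f ^^ n) x \<in> ?G (n div m)"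
    using tempered[OF m(1)] unfolding eventually_sequentially by blast
  have "(f ^^ n) x \<in> (\<Union>k. ?G k)" for n
    by (induction n) (use x growth_level_pushforward[OF f(1) inX M] in auto)
  then have "\<forall>n. \<exists>k. (f ^^ n) x \<in> ?G k" by blast
  from choice[OF this] obtain h where h: "\<And>n. (f ^^ n) x \<in> ?G (h n)" by blast
  \<comment> \<open>Adding k to the level accounts for the finitely many times before N.\<close>
  define k where "k = sum h {..<N}"
  have inc: "?G i \<subseteq> ?G j" if "i \<le> j" for i j
    using incseqD[OF incseq_growth_level[of M X f c] that] M by simp
  have level: "(f ^^ n) x \<in> ?G (k + n div m)" for n
  proof (cases "n < N")
    case True
    then have "h n \<le> k + n div m" unfolding k_def by (simp add: member_le_sum trans_le_add1)
    then show ?thesis using h inc by blast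
  next
    case False
    then show ?thesis using N[of n] inc[of "n div m" "k + n div m"] by auto
  qed
  define \<beta> where "\<beta> = L + \<delta> / 2"
  have step: "norm (tangent_map X (f ^^ n) ((f ^^ s) x) v) \<le> M ^ k * exp (\<beta> * real (n + s)) * norm v"
    if v: "v \<in> tangent_space X ((f ^^ s) x)" for n s v
  proof -
    have "M ^ (s div m) = exp (ln M * real (s div m))"
      using M by (simp add: exp_of_nat2_mult)
    also have "\<dots> \<le> exp (\<beta> * real s)"
    proof -
      have "ln M * real (s div m) \<le> ln M * (real s / real m)"
        using M by (intro mult_left_mono of_nat_div_le_of_nat) auto
      also have "\<dots> = (ln M / real m) * real s" by simp
      also have "\<dots> \<le> (\<delta> / 2) * real s" using m(2) by (intro mult_right_mono) auto
      also have "\<dots> \<le> \<beta> * real s" unfolding \<beta>_def using L by (intro mult_right_mono) auto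
      finally show ?thesis by simp
    qed
    finally have 1: "M ^ (s div m) \<le> exp (\<beta> * real s)" .
    have 2: "exp (c * real n) \<le> exp (\<beta> * real n)"
      using c unfolding \<beta>_def by (simp add: mult_right_mono)
    have "M ^ (k + s div m) * exp (c * real n) = M ^ k * (M ^ (s div m) * exp (c * real n))"
      by (simp add: power_add)
    also have "\<dots> \<le> M ^ k * (exp (\<beta> * real s) * exp (\<beta> * real n))"
      using 1 2 M by (intro mult_left_mono mult_mono) auto
    finally have 3: "M ^ (k + s div m) * exp (c * real n) \<le> M ^ k * exp (\<beta> * real (n + s))"
      by (simp add: exp_add[symmetric] algebra_simps)
    have "lipschitz_near X (f ^^ n) ((f ^^ s) x) (M ^ (k + s div m) * exp (c * real n))"
      using level[of s] unfolding growth_level_def by blast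
    from lipschitz_near_mono[OF this 3 order_refl] show ?thesis
      using funpow_differentiable[OF f(1) inX] v by (intro lipschitz_near_tangent_map_le) auto
  qed
  show ?thesis
  proof (intro exI[of _ "M ^ k * (2 / \<delta>)"] allI impI)
    fix K :: real and C :: "nat \<Rightarrow> 'a" and t
    assume K: "K > 0" and C: "\<forall>t\<ge>1. C t \<in> tangent_space X ((f ^^ t) x) \<and> norm (C t) \<le> K"
    have "norm (cocycle_sum X f x C t) \<le> real t * (M ^ k * exp (\<beta> * real t) * K)"
      using f _ _ step by (rule norm_cocycle_sum_le) (use C M in auto)
    also have "\<dots> \<le> (2 / \<delta> * exp (\<delta> / 2 * real t)) * (M ^ k * exp (\<beta> * real t) * K)"
    proof (rule mult_right_mono)
      have "\<delta> / 2 * real t \<le> exp (\<delta> / 2 * real t)"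
        using exp_ge_add_one_self[of "\<delta> / 2 * real t"] by linarith
      then show "real t \<le> 2 / \<delta> * exp (\<delta> / 2 * real t)" using \<delta> by (simp add: field_simps)
    qed (use M K in auto)
    also have "\<dots> = M ^ k * (2 / \<delta>) * K * (exp (\<delta> / 2 * real t) * exp (\<beta> * real t))"
      by (simp add: algebra_simps)
    also have "exp (\<delta> / 2 * real t) * exp (\<beta> * real t) = exp (real t * (L + \<delta>))"
      unfolding exp_add[symmetric] \<beta>_def by (simp add: algebra_simps)
    finally show "norm (cocycle_sum X f x C t) \<le> M ^ k * (2 / \<delta>) * K * exp (real t * (L + \<delta>))" .
  qed
qed

text \<open>The points whose whole two-sided orbit avoids an exceptional null set.\<close>

lemma invariant_full_measure_set:
  assumes "prob_space M" and T: "T \<in> measurable M M" "distr M M T = M"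
    and g: "g \<in> measurable M M" "\<And>x. x \<in> space M \<Longrightarrow> g (T x) = x" "\<And>x. x \<in> space M \<Longrightarrow> T (g x) = x"
    and P: "AE x in M. P x"
  shows "\<exists>\<Lambda>\<in>sets M. T ` \<Lambda> = \<Lambda> \<and> measure M \<Lambda> = 1 \<and> (\<forall>x\<in>\<Lambda>. P x)"
proof -
  interpret prob_space M by fact
  have "distr M M g = distr (distr M M T) M g" by (simp only: T(2))
  also have "\<dots> = distr M M (g \<circ> T)" by (rule distr_distr[OF g(1) T(1)])
  also have "\<dots> = distr M M (\<lambda>x. x)" by (rule distr_cong) (use g(2) in auto)
  also have "\<dots> = M" by simp
  finally have dg: "distr M M g = M" .
  obtain N where N: "{x \<in> space M. \<not> P x} \<subseteq> N" "emeasure M N = 0" "N \<in> sets M"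
    using AE_E[OF P] by blast
  have notN: "AE x in M. x \<notin> N" using N by (intro AE_not_in) auto
  define \<Lambda> where "\<Lambda> = {x \<in> space M. \<forall>n. (T ^^ n) x \<notin> N \<and> (g ^^ n) x \<notin> N}"
  have meas: "\<Lambda> \<in> sets M"
    using N(3) T(1) g(1) unfolding \<Lambda>_def by measurable
  have "AE x in M. \<forall>n. (T ^^ n) x \<notin> N \<and> (g ^^ n) x \<notin> N"
    unfolding AE_all_countable using AE_funpow[OF T notN] AE_funpow[OF g(1) dg notN] by auto
  then have "AE x in M. x \<in> \<Lambda>" unfolding \<Lambda>_def by auto
  then have "measure M \<Lambda> = 1" using prob_eq_1[OF meas] by blast
  moreover have "P x" if "x \<in> \<Lambda>" for x
  proof -
    have "x \<in> space M" "(T ^^ 0) x \<notin> N" using that unfolding \<Lambda>_def by blast+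
    then show ?thesis using N(1) by auto
  qed
  moreover have "T ` \<Lambda> = \<Lambda>"
  proof -
    have inv: "T x \<in> \<Lambda>" if "x \<in> \<Lambda>" "T \<in> measurable M M" "\<And>x. x \<in> space M \<Longrightarrow> g (T x) = x"
      "\<Lambda> = {x \<in> space M. \<forall>n. (T ^^ n) x \<notin> N \<and> (g ^^ n) x \<notin> N}" for T g x
    proof -
      have x: "x \<in> space M" "\<And>n. (T ^^ n) x \<notin> N" "\<And>n. (g ^^ n) x \<notin> N"
        using that(1,4) by auto
      have "(T ^^ n) (T x) \<notin> N" for n using x(2)[of "Suc n"] by (simp add: funpow_swap1)
      moreover have "(g ^^ n) (T x) \<notin> N" for n
      proof (cases n)
        case 0
        then show ?thesis using x(2)[of 1] by simp
      next
        case (Suc j)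
        then show ?thesis using x(3)[of j] that(3)[OF x(1)] by (simp add: funpow_swap1)
      qed
      moreover have "T x \<in> space M" using x(1) that(2) measurable_space by metis
      ultimately show ?thesis unfolding that(4) by blast
    qed
    have "T x \<in> \<Lambda>" if "x \<in> \<Lambda>" for x using inv[OF that T(1) g(2) \<Lambda>_def] .
    moreover have "g x \<in> \<Lambda>" if "x \<in> \<Lambda>" for x
      using inv[OF that g(1) g(3)] unfolding \<Lambda>_def by (simp add: conj_commute)
    moreover have "T (g x) = x" if "x \<in> \<Lambda>" for x using that g(3) unfolding \<Lambda>_def by blast
    ultimately show ?thesis by (metis image_eqI image_subsetI subset_antisym subsetI)
  qed
  ultimately show ?thesis using meas by blast
qed

lemma invariant_borel_prob_inverse:
  assumes f: "C1_diffeo X f" "X' \<subseteq> X" "compact X'" "invariant_set f X'"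
    and \<mu>: "invariant_borel_prob f X' \<mu>"
  shows "inv_into X f \<in> measurable \<mu> \<mu>"
proof -
  have sets: "sets \<mu> = sets (restrict_space borel X')"
    using \<mu> unfolding invariant_borel_prob_def by blast
  have inj: "inj_on f X" using f(1) unfolding C1_diffeo_def bij_betw_def by blast
  have img: "f ` X' = X'" using f(4) unfolding invariant_set_def .
  have gf: "inv_into X f (f x) = x" if "x \<in> X'" for x
    using inj f(2) that by auto
  have "continuous_on X f"
    using f(1) C1_map_differentiable differentiable_imp_continuous_within
    unfolding C1_diffeo_def continuous_on_eq_continuous_within by blast
  then have "continuous_on X' f" using f(2) continuous_on_subset by blast
  from continuous_on_inv[OF this f(3)] gf have cont: "continuous_on X' (inv_into X f)"
    unfolding img by blast
  have "inv_into X f \<in> X' \<rightarrow> X'"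
  proof
    fix y assume "y \<in> X'"
    then obtain x where "x \<in> X'" "y = f x" using img by blast
    then show "inv_into X f y \<in> X'" using gf by simp
  qed
  then have "inv_into X f \<in> measurable (restrict_space borel X') (restrict_space borel X')"
    using borel_measurable_continuous_on_restrict[OF cont]
    by (intro measurable_restrict_space2) (auto simp: space_restrict_space)
  then show ?thesis using measurable_cong_sets[OF sets sets] by blast
qed

theorem theorem3p1:
  fixes X X' :: "(real ^ 'L) set" and \<Phi> :: "real ^ 'L \<Rightarrow> real ^ 'L"
    and q :: nat and \<mu> :: "(real ^ 'L) measure"
  assumes "C1_submanifold q X"
    and "C1_diffeo X \<Phi>"
    and "X' \<subseteq> X" and "compact X'" and "invariant_set \<Phi> X'"
    and "invariant_borel_prob \<Phi> X' \<mu>"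
  shows "\<exists>\<Lambda> \<subseteq> X'. invariant_set \<Phi> \<Lambda> \<and> \<Lambda> \<in> sets \<mu> \<and> measure \<mu> \<Lambda> = 1 \<and>
    (\<forall>x\<in>\<Lambda>. \<exists>\<delta>\<^sub>0>0. \<forall>\<delta>::real. 0 < \<delta> \<and> \<delta> < \<delta>\<^sub>0 \<longrightarrow>
      (\<exists>R::real. \<forall>K::real. \<forall>C :: nat \<Rightarrow> real ^ 'L.
        K > 0 \<longrightarrow>
        (\<forall>t\<ge>1. C t \<in> tangent_space X ((\<Phi> ^^ t) x) \<and> norm (C t) \<le> K) \<longrightarrow>
        (\<forall>t\<ge>1. norm (cocycle_sum X \<Phi> x C t)
           \<le> R * K * exp (real t * (real_of_ereal (max (largest_lyapunov X \<Phi> x) 0) + \<delta>)))))"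
proof -
  note f = assms(2)
  have sets: "sets \<mu> = sets (restrict_space borel X')" and P: "prob_space \<mu>"
    and T: "\<Phi> \<in> measurable \<mu> \<mu>" "distr \<mu> \<mu> \<Phi> = \<mu>"
    using assms(6) unfolding invariant_borel_prob_def by blast+
  have space: "space \<mu> = X'"
    using sets_eq_imp_space_eq[OF sets] by (simp add: space_restrict_space)
  have img: "\<Phi> ` X' = X'" using assms(5) unfolding invariant_set_def .
  have imgX: "\<Phi> ` X = X" and inj: "inj_on \<Phi> X"
    using f unfolding C1_diffeo_def bij_betw_def by auto
  obtain M where M: "M > 1" "\<And>x. x \<in> X' \<Longrightarrow> lipschitz_near X \<Phi> x M"
    using uniform_lipschitz_near_compact[OF _ assms(3,4)] f unfolding C1_diffeo_def by blast
  define G where "G = (\<lambda>c k. X' \<inter> growth_level X \<Phi> M c k)"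
  have UG: "(\<Union>k. G c k) = X' \<inter> (\<Union>k. growth_level X \<Phi> M c k)" for c
    unfolding G_def by blast
  have tempered: "AE x in \<mu>. x \<in> (\<Union>k. G c k) \<longrightarrow>
      (\<forall>m\<ge>1. \<forall>\<^sub>F n in sequentially. (\<Phi> ^^ n) x \<in> G c (n div m))" if c: "c \<ge> 0" for c
  proof (rule AE_tempered[OF P T])
    show "G c k \<in> sets \<mu>" for k
      unfolding sets sets_restrict_space G_def using growth_level_borel by blast
    show "incseq (G c)"
      unfolding G_def using incseq_growth_level[of M X \<Phi> c] M(1) by (auto simp: incseq_def)
    show "x \<in> G c (Suc k)" if "x \<in> space \<mu>" "\<Phi> x \<in> G c k" for x k
      using growth_level_pullback[of \<Phi> X x M c k] that imgX M assms(3) c space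
      unfolding G_def by auto
    show "\<Phi> x \<in> (\<Union>k. G c k)" if "x \<in> (\<Union>k. G c k)" for x
      using that growth_level_pushforward[OF f _ M(1), of x c] img assms(3) unfolding UG by blast
  qed
  \<comment> \<open>The rates c are restricted to the rationals, so that countably many null sets are discarded
before a point x, its Lyapunov exponent and \<delta> are chosen.\<close>
  define good where "good = (\<lambda>x. \<forall>c\<in>{c\<in>\<rat>. c \<ge> 0}. x \<in> (\<Union>k. G c k) \<longrightarrow>
      (\<forall>m\<ge>1. \<forall>\<^sub>F n in sequentially. (\<Phi> ^^ n) x \<in> G c (n div m)))"
  have "countable {c\<in>\<rat>. c \<ge> (0::real)}"
    using countable_rat by (rule countable_subset[rotated]) auto
  then have AE_good: "AE x in \<mu>. good x"
    unfolding good_def by (subst AE_ball_countable) (use tempered in auto)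
  have "\<exists>\<Lambda>\<in>sets \<mu>. \<Phi> ` \<Lambda> = \<Lambda> \<and> measure \<mu> \<Lambda> = 1 \<and> (\<forall>x\<in>\<Lambda>. good x)"
  proof (rule invariant_full_measure_set[OF P T])
    show "inv_into X \<Phi> \<in> measurable \<mu> \<mu>"
      using f assms(3-6) by (rule invariant_borel_prob_inverse)
    fix x assume "x \<in> space \<mu>"
    then have "x \<in> X" using assms(3) space by blast
    then show "inv_into X \<Phi> (\<Phi> x) = x" "\<Phi> (inv_into X \<Phi> x) = x"
      using inj imgX by (auto simp: f_inv_into_f)
  qed (rule AE_good)
  then obtain \<Lambda> where \<Lambda>: "\<Lambda> \<in> sets \<mu>" "\<Phi> ` \<Lambda> = \<Lambda>" "measure \<mu> \<Lambda> = 1" "\<And>x. x \<in> \<Lambda> \<Longrightarrow> good x"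
    by blast
  have sub: "\<Lambda> \<subseteq> X'" using sets.sets_into_space[OF \<Lambda>(1)] space by simp
  have bound: "\<exists>R. \<forall>K C. K > 0 \<longrightarrow>
      (\<forall>t\<ge>1. C t \<in> tangent_space X ((\<Phi> ^^ t) x) \<and> norm (C t) \<le> K) \<longrightarrow>
      (\<forall>t. norm (cocycle_sum X \<Phi> x C t) \<le>
        R * K * exp (real t * (real_of_ereal (max (largest_lyapunov X \<Phi> x) 0) + \<delta>)))"
    if x: "x \<in> \<Lambda>" and \<delta>: "\<delta> > 0" for x \<delta>
  proof -
    have xX': "x \<in> X'" and xX: "x \<in> X" using x sub assms(3) by auto
    have orbit: "(\<Phi> ^^ n) x \<in> X'" for n using xX' img by (induction n) auto
    define L where "L = real_of_ereal (max (largest_lyapunov X \<Phi> x) 0)"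
    have "largest_lyapunov X \<Phi> x \<le> ereal (ln M)"
      by (rule largest_lyapunov_le[OF f xX M(1) M(2)[OF orbit]])
    then have L: "ereal L = max (largest_lyapunov X \<Phi> x) 0"
      unfolding L_def by (intro ereal_real') (auto simp: max_def)
    then have L0: "L \<ge> 0" "largest_lyapunov X \<Phi> x \<le> ereal L"
      by (metis ereal_less_eq(5) max.cobounded2) (metis L max.cobounded1)
    obtain c where c: "c \<in> \<rat>" "L < c" "c < L + \<delta> / 2"
      using Rats_dense_in_real[of L "L + \<delta> / 2"] \<delta> by auto
    have "largest_lyapunov X \<Phi> x < ereal c" using L0(2) c(2) by (simp add: le_less_trans)
    then have level: "x \<in> (\<Union>k. growth_level X \<Phi> M c k)"
      using L0(1) c(2) by (intro growth_level_of_lyapunov[OF assms(1) f xX _ _ M(1)]) auto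
    then have "\<forall>m\<ge>1. \<forall>\<^sub>F n in sequentially. (\<Phi> ^^ n) x \<in> G c (n div m)"
      using \<Lambda>(4)[OF x] xX' c L0(1) unfolding good_def UG by auto
    then have "\<forall>\<^sub>F n in sequentially. (\<Phi> ^^ n) x \<in> growth_level X \<Phi> M c (n div m)" if "m \<ge> 1" for m
      using that unfolding G_def by (auto elim: eventually_mono)
    then show ?thesis
      unfolding L_def[symmetric] using c L0(1)
      by (intro cocycle_sum_bound_of_tempered[OF f xX M(1) \<delta> L0(1) _ level]) auto
  qed
  show ?thesis
    unfolding invariant_set_def
  proof (intro exI[of _ \<Lambda>] conjI ballI sub \<Lambda>(1-3))
    fix x assume x: "x \<in> \<Lambda>"
    show "\<exists>\<delta>\<^sub>0>0. \<forall>\<delta>::real. 0 < \<delta> \<and> \<delta> < \<delta>\<^sub>0 \<longrightarrow>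
      (\<exists>R::real. \<forall>K::real. \<forall>C :: nat \<Rightarrow> real ^ 'L.
        K > 0 \<longrightarrow>
        (\<forall>t\<ge>1. C t \<in> tangent_space X ((\<Phi> ^^ t) x) \<and> norm (C t) \<le> K) \<longrightarrow>
        (\<forall>t\<ge>1. norm (cocycle_sum X \<Phi> x C t)
           \<le> R * K * exp (real t * (real_of_ereal (max (largest_lyapunov X \<Phi> x) 0) + \<delta>))))"
      using bound[OF x] by (intro exI[of _ 1]) (meson zero_less_one)
  qed
qed

end
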